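(* Let $S$ be a $\mathrm{Cu}$-semigroup. Then $S$ is $\mathrm{Lsc}$-like if and only if $S$ is $\mathrm{Cu}$-isomorphic to $\mathrm{Lsc}(X,\overline{\mathbb{N}})$ for a $T_1$ topological space $X$.
   Context: Cu-semigroups. In a partially ordered set, $x\ll y$ ($x$ is way-below $y$) means: for every increasing sequence $(z_n)_n$ whose supremum exists and is $\geq y$, there is $n$ with $x\leq z_n$. A $\mathrm{Cu}$-semigroup is a positively ordered (commutative) monoid $S$ (partial order compatible with addition, $0\leq x$ for all $x$) such that: (O1) increasing sequences have suprema; (O2) every element is the supremum of an $\ll$-increasing sequence; (O3) $x'\ll x$ and $y'\ll y$ imply $x'+y'\ll x+y$; (O4) $\sup_n x_n+\sup_n y_n=\sup_n(x_n+y_n)$ for increasing sequences. A $\mathrm{Cu}$-morphism is an order- and addition-preserving map, with $0\mapsto 0$, that preserves suprema of increasing sequences and $\ll$; a $\mathrm{Cu}$-isomorphism is an isomorphism in this category. Lsc-like. $S$ is distributively lattice ordered if it is a distributive lattice and $x+y=(x\vee y)+(x\wedge y)$ for all $x,y$; it is complete if suprema of arbitrary subsets exist. If $S$ has a greatest element it is denoted $\infty$. A subset $H\subseteq S$ is topological if for any two finite increasing sequences $(x_i)_{i=1}^m,(y_i)_{i=1}^m$ in $H$ one has $\sum_i x_i\leq\sum_i y_i$ iff $x_i\leq y_i$ for every $i$. Let $\downarrow e=\{s\in S: s\leq e\}$. $S$ is $\mathrm{Lsc}$-like if it is a complete distributively lattice ordered $\mathrm{Cu}$-semigroup such that: (C1)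 for all idempotents $y,z$ (elements with $y+y=y$, $z+z=z$), $y\geq z$ iff $\{x<\infty: x$ maximal idempotent, $x\geq y\}\subseteq\{x<\infty: x$ maximal idempotent, $x\geq z\}$, where "$x<\infty$ maximal idempotent" means maximal among idempotents different from $\infty$; (C2) there is a topological subset of the form $\downarrow e$ such that the finite sums of elements of $\downarrow e$ are sup-dense in $S$ (every element of $S$ is the supremum of an increasing sequence of such sums). $\mathrm{Lsc}(X,\overline{\mathbb{N}})$ is the positively ordered monoid of lower semicontinuous functions $X\to\overline{\mathbb{N}}=\{0,1,\dots,\infty\}$ (i.e. $f^{-1}([n,\infty])$ open for every $n$) with pointwise order and addition. *)

theory Defs
  imports
    "HOL-Algebra.FiniteProduct"
    "HOL-Analysis.T1_Spaces"
    "HOL-Library.Extended_Nat"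
begin

section \<open>Positively ordered monoids\<close>

record 'a ordered_monoid = "'a gorder" +
  oplus :: "['a, 'a] \<Rightarrow> 'a" (infixl \<open>\<boxplus>\<index>\<close> 65)
  ozero :: 'a

text \<open>The additive structure as a (multiplicatively written) library monoid; in particular
  finite sums in \<open>S\<close> are \<open>finprod (monoid_of S)\<close>.\<close>

definition monoid_of :: "'a ordered_monoid \<Rightarrow> 'a monoid" where
  "monoid_of S = \<lparr>carrier = carrier S, mult = oplus S, one = ozero S\<rparr>"

abbreviation osum :: "'a ordered_monoid \<Rightarrow> (nat \<Rightarrow> 'a) \<Rightarrow> nat \<Rightarrow> 'a" where
  "osum S x m \<equiv> finprod (monoid_of S) x {..<m}"

locale positively_ordered_monoid = partial_order S
  for S :: "'a ordered_monoid" (structure) +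
  assumes comm_monoid_monoid_of: "comm_monoid (monoid_of S)"
    and add_mono: "\<lbrakk>x \<in> carrier S; x' \<in> carrier S; y \<in> carrier S; y' \<in> carrier S;
      x \<sqsubseteq> x'; y \<sqsubseteq> y'\<rbrakk> \<Longrightarrow> x \<boxplus> y \<sqsubseteq> x' \<boxplus> y'"
    and zero_le: "x \<in> carrier S \<Longrightarrow> ozero S \<sqsubseteq> x"

section \<open>Cu-semigroups\<close>

definition increasing :: "'a ordered_monoid \<Rightarrow> (nat \<Rightarrow> 'a) \<Rightarrow> bool" where
  "increasing S z \<longleftrightarrow> (\<forall>n. z n \<in> carrier S \<and> z n \<sqsubseteq>\<^bsub>S\<^esub> z (Suc n))"

abbreviation is_seq_sup :: "'a ordered_monoid \<Rightarrow> 'a \<Rightarrow> (nat \<Rightarrow> 'a) \<Rightarrow> bool" where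
  "is_seq_sup S s z \<equiv> is_lub S s (range z)"

definition way_below :: "'a ordered_monoid \<Rightarrow> 'a \<Rightarrow> 'a \<Rightarrow> bool" where
  "way_below S x y \<longleftrightarrow> x \<in> carrier S \<and> y \<in> carrier S \<and>
     (\<forall>z s. increasing S z \<and> is_seq_sup S s z \<and> y \<sqsubseteq>\<^bsub>S\<^esub> s \<longrightarrow> (\<exists>n. x \<sqsubseteq>\<^bsub>S\<^esub> z n))"

locale cu_semigroup = positively_ordered_monoid +
  assumes O1: "increasing S z \<Longrightarrow> \<exists>s. is_seq_sup S s z"
    and O2: "x \<in> carrier S \<Longrightarrow>
      \<exists>z. (\<forall>n. way_below S (z n) (z (Suc n))) \<and> is_seq_sup S x z"
    and O3: "\<lbrakk>way_below S x' x; way_below S y' y\<rbrakk> \<Longrightarrow> way_below S (x' \<boxplus> y') (x \<boxplus> y)"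
    and O4: "\<lbrakk>increasing S u; increasing S v; is_seq_sup S s u; is_seq_sup S t v\<rbrakk>
      \<Longrightarrow> is_seq_sup S (s \<boxplus> t) (\<lambda>n. u n \<boxplus> v n)"

definition cu_morphism ::
  "'a ordered_monoid \<Rightarrow> 'b ordered_monoid \<Rightarrow> ('a \<Rightarrow> 'b) \<Rightarrow> bool" where
  "cu_morphism S T f \<longleftrightarrow>
     f \<in> carrier S \<rightarrow> carrier T \<and>
     (\<forall>x\<in>carrier S. \<forall>y\<in>carrier S. x \<sqsubseteq>\<^bsub>S\<^esub> y \<longrightarrow> f x \<sqsubseteq>\<^bsub>T\<^esub> f y) \<and>
     (\<forall>x\<in>carrier S. \<forall>y\<in>carrier S. f (x \<boxplus>\<^bsub>S\<^esub> y) = f x \<boxplus>\<^bsub>T\<^esub> f y) \<and>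
     f (ozero S) = ozero T \<and>
     (\<forall>z s. increasing S z \<and> is_seq_sup S s z \<longrightarrow> is_seq_sup T (f s) (\<lambda>n. f (z n))) \<and>
     (\<forall>x y. way_below S x y \<longrightarrow> way_below T (f x) (f y))"

definition cu_isomorphic :: "'a ordered_monoid \<Rightarrow> 'b ordered_monoid \<Rightarrow> bool" where
  "cu_isomorphic S T \<longleftrightarrow> cu_semigroup S \<and> cu_semigroup T \<and>
     (\<exists>f g. cu_morphism S T f \<and> cu_morphism T S g \<and>
        (\<forall>x\<in>carrier S. g (f x) = x) \<and> (\<forall>y\<in>carrier T. f (g y) = y))"

section \<open>Lsc-like Cu-semigroups\<close>

definition sup_complete :: "'a ordered_monoid \<Rightarrow> bool" where
  "sup_complete S \<longleftrightarrow> (\<forall>A. A \<subseteq> carrier S \<longrightarrow> (\<exists>s. is_lub S s A))"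

definition distributively_lattice_ordered :: "'a ordered_monoid \<Rightarrow> bool" where
  "distributively_lattice_ordered S \<longleftrightarrow> lattice S \<and>
     (\<forall>x\<in>carrier S. \<forall>y\<in>carrier S. \<forall>z\<in>carrier S.
        x \<sqinter>\<^bsub>S\<^esub> (y \<squnion>\<^bsub>S\<^esub> z) = (x \<sqinter>\<^bsub>S\<^esub> y) \<squnion>\<^bsub>S\<^esub> (x \<sqinter>\<^bsub>S\<^esub> z)) \<and>
     (\<forall>x\<in>carrier S. \<forall>y\<in>carrier S.
        x \<boxplus>\<^bsub>S\<^esub> y = (x \<squnion>\<^bsub>S\<^esub> y) \<boxplus>\<^bsub>S\<^esub> (x \<sqinter>\<^bsub>S\<^esub> y))"

definition idempotents :: "'a ordered_monoid \<Rightarrow> 'a set" where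
  "idempotents S = {x \<in> carrier S. x \<boxplus>\<^bsub>S\<^esub> x = x}"

text \<open>The idempotents that are maximal among those different from the greatest element of \<open>S\<close>
  (if there is one).\<close>

definition maximal_idempotents :: "'a ordered_monoid \<Rightarrow> 'a set" where
  "maximal_idempotents S =
     {x \<in> idempotents S. \<not> greatest S x (carrier S) \<and>
        (\<forall>y\<in>idempotents S. \<not> greatest S y (carrier S) \<and> x \<sqsubseteq>\<^bsub>S\<^esub> y \<longrightarrow> y = x)}"

definition down_set :: "'a ordered_monoid \<Rightarrow> 'a \<Rightarrow> 'a set" where
  "down_set S e = {s \<in> carrier S. s \<sqsubseteq>\<^bsub>S\<^esub> e}"

definition finite_increasing_in :: "'a ordered_monoid \<Rightarrow> 'a set \<Rightarrow> nat \<Rightarrow> (nat \<Rightarrow> 'a) \<Rightarrow> bool" where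
  "finite_increasing_in S H m x \<longleftrightarrow>
     (\<forall>i<m. x i \<in> H) \<and> (\<forall>i. Suc i < m \<longrightarrow> x i \<sqsubseteq>\<^bsub>S\<^esub> x (Suc i))"

definition topological_subset :: "'a ordered_monoid \<Rightarrow> 'a set \<Rightarrow> bool" where
  "topological_subset S H \<longleftrightarrow> H \<subseteq> carrier S \<and>
     (\<forall>m x y. finite_increasing_in S H m x \<and> finite_increasing_in S H m y \<longrightarrow>
        (osum S x m \<sqsubseteq>\<^bsub>S\<^esub> osum S y m \<longleftrightarrow> (\<forall>i<m. x i \<sqsubseteq>\<^bsub>S\<^esub> y i)))"

definition finite_sums :: "'a ordered_monoid \<Rightarrow> 'a set \<Rightarrow> 'a set" where
  "finite_sums S H = {osum S x m | x m. \<forall>i<m. x i \<in> H}"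

definition sup_dense :: "'a ordered_monoid \<Rightarrow> 'a set \<Rightarrow> bool" where
  "sup_dense S D \<longleftrightarrow>
     (\<forall>s\<in>carrier S. \<exists>z. increasing S z \<and> range z \<subseteq> D \<and> is_seq_sup S s z)"

definition condition_C1 :: "'a ordered_monoid \<Rightarrow> bool" where
  "condition_C1 S \<longleftrightarrow> (\<forall>y\<in>idempotents S. \<forall>z\<in>idempotents S.
     z \<sqsubseteq>\<^bsub>S\<^esub> y \<longleftrightarrow>
       {x \<in> maximal_idempotents S. y \<sqsubseteq>\<^bsub>S\<^esub> x} \<subseteq> {x \<in> maximal_idempotents S. z \<sqsubseteq>\<^bsub>S\<^esub> x})"

definition condition_C2 :: "'a ordered_monoid \<Rightarrow> bool" where
  "condition_C2 S \<longleftrightarrow> (\<exists>e\<in>carrier S. topological_subset S (down_set S e) \<and>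
     sup_dense S (finite_sums S (down_set S e)))"

definition Lsc_like :: "'a ordered_monoid \<Rightarrow> bool" where
  "Lsc_like S \<longleftrightarrow> cu_semigroup S \<and> sup_complete S \<and> distributively_lattice_ordered S \<and>
     condition_C1 S \<and> condition_C2 S"

section \<open>Lower semicontinuous functions\<close>

text \<open>Functions on the point set of \<open>X\<close> are represented as extensional functions on
  \<^term>\<open>topspace X\<close>, so that equality of elements is HOL equality.\<close>

definition Lsc :: "'x topology \<Rightarrow> ('x \<Rightarrow> enat) ordered_monoid" where
  "Lsc X = \<lparr>
     carrier = {f \<in> topspace X \<rightarrow>\<^sub>E UNIV. \<forall>n::nat. openin X {x \<in> topspace X. enat n \<le> f x}},
     eq = (=),
     le = (\<lambda>f g. \<forall>x\<in>topspace X. f x \<le> g x),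
     oplus = (\<lambda>f g. \<lambda>x\<in>topspace X. f x + g x),
     ozero = (\<lambda>x\<in>topspace X. 0)\<rparr>"

end

theory Submission
  imports Defs
begin

text \<open>Let \<open>S\<close> be \<open>Lsc\<close>-like, with topological down-set \<open>H = \<down>e\<close>. The identity
  \<open>x + y = (x \<or> y) + (x \<and> y)\<close> sorts every finite sum of elements of \<open>H\<close> into a decreasing one, and
  taking suprema each \<open>s\<close> becomes \<open>sup\<^sub>n (x\<^sub>0 + \<dots> + x\<^sub>n)\<close> for a decreasing sequence \<open>x\<close> in \<open>H\<close>.
  For \<open>h \<in> H\<close> one has \<open>(i + 1) h \<le> s\<close> iff \<open>h \<le> x\<^sub>i\<close>; hence \<open>x\<close> is determined by \<open>s\<close>, and the order
  of \<open>S\<close> is the componentwise order of these sequences. Idempotents correspond to constant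
  sequences, that is to elements of \<open>H\<close>, so by (C1) the sets \<open>{p. \<not> h \<le> p}\<close> of maximal idempotents
  \<open>p\<close> form a \<open>T\<^sub>1\<close> topology isomorphic to \<open>H\<close>. The function attached to \<open>s\<close> counts at \<open>p\<close> the
  indices \<open>i\<close> with \<open>\<not> x\<^sub>i \<le> p\<close>.\<close>

section \<open>Finite sums and suprema of sequences\<close>

text \<open>The topological condition compares only finite sums of equal length, whereas a general
  \<open>s\<close> is a supremum of such sums. Way-below approximation bridges this gap: if
  \<open>z\<close> is way below \<open>h\<close> and \<open>(k + 1) h\<close> lies below
  \<open>s\<close>, then \<open>(k + 1) z\<close> already lies below a partial sum, and padding with
  zeros equalises the lengths. Addition is the second obstacle. Instead of computing the
  coefficients of \<open>s + t\<close> in general, additivity is checked for one added generator,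
  where insertion displays the new coefficients, and is extended by induction to finite sums and by
  (O4) to suprema. In the end only order, zero and addition are matched with those of the functions;
  everything else, including the \<open>Cu\<close> axioms of the function monoid, is transported
  along the bijection.\<close>

lemma Upper_eq: "A \<subseteq> carrier S \<Longrightarrow> Upper S A = {u \<in> carrier S. \<forall>a\<in>A. a \<sqsubseteq>\<^bsub>S\<^esub> u}"
  unfolding Upper_def by auto

lemma Lower_eq: "A \<subseteq> carrier S \<Longrightarrow> Lower S A = {l \<in> carrier S. \<forall>a\<in>A. l \<sqsubseteq>\<^bsub>S\<^esub> a}"
  unfolding Lower_def by auto

lemma is_lub_iff:
  assumes "A \<subseteq> carrier S"
  shows "is_lub S s A \<longleftrightarrow> s \<in> carrier S \<and> (\<forall>a\<in>A. a \<sqsubseteq>\<^bsub>S\<^esub> s) \<and>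
    (\<forall>t\<in>carrier S. (\<forall>a\<in>A. a \<sqsubseteq>\<^bsub>S\<^esub> t) \<longrightarrow> s \<sqsubseteq>\<^bsub>S\<^esub> t)"
  using assms by (auto simp: least_def Upper_eq)

lemma is_glb_iff:
  assumes "A \<subseteq> carrier S"
  shows "is_glb S s A \<longleftrightarrow> s \<in> carrier S \<and> (\<forall>a\<in>A. s \<sqsubseteq>\<^bsub>S\<^esub> a) \<and>
    (\<forall>t\<in>carrier S. (\<forall>a\<in>A. t \<sqsubseteq>\<^bsub>S\<^esub> a) \<longrightarrow> t \<sqsubseteq>\<^bsub>S\<^esub> s)"
  using assms by (auto simp: greatest_def Lower_eq)

lemma is_seq_sup_iff:
  assumes "\<And>n. z n \<in> carrier S"
  shows "is_seq_sup S s z \<longleftrightarrow> s \<in> carrier S \<and> (\<forall>n. z n \<sqsubseteq>\<^bsub>S\<^esub> s) \<and>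
    (\<forall>t\<in>carrier S. (\<forall>n. z n \<sqsubseteq>\<^bsub>S\<^esub> t) \<longrightarrow> s \<sqsubseteq>\<^bsub>S\<^esub> t)"
  using assms by (subst is_lub_iff) auto

context positively_ordered_monoid
begin

(* These inherited introduction rules make classical search on order goals diverge. *)
declare le_cong_l [rule del] le_cong_r [rule del] weak_refl [rule del, simp del]

lemma monoid_of_simps [simp]:
  "carrier (monoid_of S) = carrier S" "mult (monoid_of S) = oplus S" "one (monoid_of S) = ozero S"
  by (simp_all add: monoid_of_def)

lemma ozero_closed [simp, intro]: "ozero S \<in> carrier S"
  and oplus_closed [simp, intro]: "\<lbrakk>x \<in> carrier S; y \<in> carrier S\<rbrakk> \<Longrightarrow> x \<boxplus> y \<in> carrier S"
  and oplus_assoc: "\<lbrakk>x \<in> carrier S; y \<in> carrier S; z \<in> carrier S\<rbrakk>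
      \<Longrightarrow> (x \<boxplus> y) \<boxplus> z = x \<boxplus> (y \<boxplus> z)"
  and oplus_comm: "\<lbrakk>x \<in> carrier S; y \<in> carrier S\<rbrakk> \<Longrightarrow> x \<boxplus> y = y \<boxplus> x"
  and oplus_ozero [simp]: "x \<in> carrier S \<Longrightarrow> x \<boxplus> ozero S = x"
  and ozero_oplus [simp]: "x \<in> carrier S \<Longrightarrow> ozero S \<boxplus> x = x"
proof -
  interpret M: comm_monoid "monoid_of S"
    by (rule comm_monoid_monoid_of)
  show "ozero S \<in> carrier S"
    "\<lbrakk>x \<in> carrier S; y \<in> carrier S\<rbrakk> \<Longrightarrow> x \<boxplus> y \<in> carrier S"
    "\<lbrakk>x \<in> carrier S; y \<in> carrier S; z \<in> carrier S\<rbrakk> \<Longrightarrow> (x \<boxplus> y) \<boxplus> z = x \<boxplus> (y \<boxplus> z)"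
    "\<lbrakk>x \<in> carrier S; y \<in> carrier S\<rbrakk> \<Longrightarrow> x \<boxplus> y = y \<boxplus> x"
    "x \<in> carrier S \<Longrightarrow> x \<boxplus> ozero S = x" "x \<in> carrier S \<Longrightarrow> ozero S \<boxplus> x = x"
    using M.one_closed M.m_closed[of x y] M.m_assoc[of x y z] M.m_comm[of x y] M.r_one[of x]
      M.l_one[of x]
    by auto
qed

lemma le_add_right: "\<lbrakk>x \<in> carrier S; y \<in> carrier S\<rbrakk> \<Longrightarrow> x \<sqsubseteq> x \<boxplus> y"
  using add_mono[of x x "ozero S" y] zero_le[of y] by simp

lemma osum_empty [simp]: "finprod (monoid_of S) x {} = ozero S"
  using comm_monoid.finprod_empty[OF comm_monoid_monoid_of] by simp

lemma osum_cong: "\<lbrakk>\<And>i. i < n \<Longrightarrow> x i = y i; \<And>i. i < n \<Longrightarrow> y i \<in> carrier S\<rbrakk> \<Longrightarrow> osum S x n = osum S y n"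
  by (rule comm_monoid.finprod_cong'[OF comm_monoid_monoid_of]) (simp_all add: Pi_def)

lemma osum_Suc:
  assumes "\<And>i. i \<le> n \<Longrightarrow> x i \<in> carrier S"
  shows "osum S x (Suc n) = osum S x n \<boxplus> x n"
proof -
  interpret M: comm_monoid "monoid_of S"
    by (rule comm_monoid_monoid_of)
  have c: "osum S x n \<in> carrier S"
    using M.finprod_closed[of x "{..<n}"] assms by auto
  have "osum S x (Suc n) = x n \<boxplus> osum S x n"
    using M.finprod_insert[of "{..<n}" n x] assms by (auto simp: lessThan_Suc)
  then show ?thesis
    using oplus_comm[OF c] assms by simp
qed

lemma osum_closed [simp, intro]:
  assumes "\<And>i. i < n \<Longrightarrow> x i \<in> carrier S"
  shows "osum S x n \<in> carrier S"
  using comm_monoid.finprod_closed[OF comm_monoid_monoid_of, of x "{..<n}"] assms by auto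

lemma osum_mono:
  assumes "\<And>i. i < n \<Longrightarrow> x i \<in> carrier S" "\<And>i. i < n \<Longrightarrow> y i \<in> carrier S"
    and "\<And>i. i < n \<Longrightarrow> x i \<sqsubseteq> y i"
  shows "osum S x n \<sqsubseteq> osum S y n"
  using assms by (induction n) (auto simp: osum_Suc intro!: add_mono)

lemma osum_le_osum:
  assumes "\<And>i. x i \<in> carrier S" "m \<le> n"
  shows "osum S x m \<sqsubseteq> osum S x n"
  using assms(2)
proof (induction n rule: dec_induct)
  case (step n)
  have "osum S x n \<sqsubseteq> osum S x (Suc n)"
    using assms(1) by (simp add: osum_Suc le_add_right)
  then show ?case
    using step le_trans assms(1) by (meson osum_closed)
qed (use assms(1) in auto)

lemma osum_pad:
  assumes "\<And>i. x i \<in> carrier S" "m \<le> n" "\<And>i. m \<le> i \<Longrightarrow> x i = ozero S"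
  shows "osum S x n = osum S x m"
  using assms(2)
  by (induction n rule: dec_induct) (use assms in \<open>auto simp: osum_Suc\<close>)

text \<open>Topological subsets are tested on increasing sequences, while the sequences attached to
  elements decrease; reversing the index range connects the two.\<close>

lemma osum_reverse:
  assumes "\<And>i. i < n \<Longrightarrow> x i \<in> carrier S"
  shows "osum S (\<lambda>i. x (n - Suc i)) n = osum S x n"
proof -
  interpret M: comm_monoid "monoid_of S"
    by (rule comm_monoid_monoid_of)
  have im: "(\<lambda>i. n - Suc i) ` {..<n} = {..<n}"
  proof (intro equalityI subsetI, goal_cases)
    case (2 i)
    then have "i = n - Suc (n - Suc i)" "n - Suc i < n"
      by auto
    then show ?case
      by blast
  qed auto
  have inj: "inj_on (\<lambda>i. n - Suc i) {..<n}"
    by (auto simp: inj_on_def)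
  show ?thesis
    using M.finprod_reindex[of x "\<lambda>i. n - Suc i" "{..<n}"] im inj assms by auto
qed

text \<open>With \<open>m = n\<close>, doubling a multiple of \<open>h\<close> gives a multiple of
  \<open>h\<close>; this is why the supremum of all multiples is idempotent.\<close>

lemma osum_const_add:
  assumes "h \<in> carrier S"
  shows "osum S (\<lambda>_. h) m \<boxplus> osum S (\<lambda>_. h) n = osum S (\<lambda>_. h) (m + n)"
proof (induction n)
  case (Suc n)
  have "osum S (\<lambda>_. h) m \<boxplus> osum S (\<lambda>_. h) (Suc n)
      = (osum S (\<lambda>_. h) m \<boxplus> osum S (\<lambda>_. h) n) \<boxplus> h"
    using assms osum_Suc[of n "\<lambda>_. h"] oplus_assoc[of "osum S (\<lambda>_. h) m" "osum S (\<lambda>_. h) n" h]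
    by simp
  then show ?case
    using assms osum_Suc[of "m + n" "\<lambda>_. h"] Suc by simp
qed (use assms in simp)

lemma increasing_osum:
  assumes "\<And>i. x i \<in> carrier S"
  shows "increasing S (osum S x)"
  using assms unfolding increasing_def by (auto simp: osum_Suc le_add_right)

lemma increasing_mono:
  assumes "increasing S z" "m \<le> n"
  shows "z m \<sqsubseteq> z n"
  using assms(2)
proof (induction n rule: dec_induct)
  case (step n)
  then show ?case
    using assms(1) le_trans unfolding increasing_def by meson
qed (use assms(1) in \<open>auto simp: increasing_def\<close>)

lemma increasingI:
  assumes "\<And>n. z n \<in> carrier S" "\<And>n. z n \<sqsubseteq> z (Suc n)"
  shows "increasing S z"
  using assms by (auto simp: increasing_def)

lemma increasing_closed: "increasing S z \<Longrightarrow> z n \<in> carrier S"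
  by (auto simp: increasing_def)

end

lemma (in lattice) le_meet_iff:
  assumes "x \<in> carrier L" "y \<in> carrier L" "z \<in> carrier L"
  shows "z \<sqsubseteq> x \<sqinter> y \<longleftrightarrow> z \<sqsubseteq> x \<and> z \<sqsubseteq> y"
  by (meson assms meet_closed meet_left meet_right meet_le le_trans)

lemma (in lattice) join_le_iff:
  assumes "x \<in> carrier L" "y \<in> carrier L" "z \<in> carrier L"
  shows "x \<squnion> y \<sqsubseteq> z \<longleftrightarrow> x \<sqsubseteq> z \<and> y \<sqsubseteq> z"
  by (meson assms join_closed join_left join_right join_le le_trans)

lemma (in positively_ordered_monoid) way_below_le:
  assumes "way_below S x y"
  shows "x \<sqsubseteq> y"
proof -
  have c: "x \<in> carrier S" "y \<in> carrier S"
    using assms by (auto simp: way_below_def)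
  then have "increasing S (\<lambda>_. y)" "is_seq_sup S y (\<lambda>_. y)"
    using c is_seq_sup_iff[of "\<lambda>_. y" S y] by (auto simp only: increasing_def le_refl)
  then show ?thesis
    using assms c unfolding way_below_def by blast
qed

lemma (in positively_ordered_monoid) way_below_trans_le:
  assumes "way_below S x y" "y \<sqsubseteq> z" "z \<in> carrier S"
  shows "way_below S x z"
proof -
  have "y \<sqsubseteq> s" if "z \<sqsubseteq> s" "is_seq_sup S s u" for s u
    using that assms le_trans[of y z s] least_closed by (auto simp: way_below_def)
  then show ?thesis
    using assms unfolding way_below_def by blast
qed

context cu_semigroup
begin

lemma way_below_osum_const:
  assumes "way_below S x y"
  shows "way_below S (osum S (\<lambda>_. x) n) (osum S (\<lambda>_. y) n)"
proof (induction n)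
  case 0
  then show ?case
    by (auto simp: way_below_def increasing_def zero_le)
next
  case (Suc n)
  then show ?case
    using O3[OF Suc assms] assms by (simp add: osum_Suc way_below_def)
qed

text \<open>(O2) relates consecutive terms only; since \<open>z (Suc n)\<close> lies below the
  supremum \<open>x\<close>, every term is way below \<open>x\<close> itself.\<close>

lemma way_below_approx:
  assumes "x \<in> carrier S"
  obtains z where "increasing S z" "is_seq_sup S x z" "\<And>n. way_below S (z n) x"
proof -
  obtain z where z: "\<And>n. way_below S (z n) (z (Suc n))" "is_seq_sup S x z"
    using O2[OF assms] by blast
  have c: "z n \<in> carrier S" for n
    using z(1)[of n] by (auto simp: way_below_def)
  have "increasing S z"
    using c z(1) way_below_le by (auto intro!: increasingI)
  moreover have "way_below S (z n) x" for n
    using way_below_trans_le[OF z(1)] assms z(2) c by (auto simp: is_seq_sup_iff)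
  ultimately show ?thesis
    using that z(2) by blast
qed

end

section \<open>Transfer along isomorphisms\<close>

text \<open>Suprema, the way-below relation, lattice operations and finite sums are determined by
  order and addition, so nothing is assumed about them. \<open>g\<close> is only a set-theoretic
  inverse; its monotonicity and additivity are derived.\<close>

locale ordered_monoid_iso =
  fixes S :: "'a ordered_monoid" and T :: "'b ordered_monoid" and f :: "'a \<Rightarrow> 'b" and g :: "'b \<Rightarrow> 'a"
  assumes partial_order_S: "partial_order S" and partial_order_T: "partial_order T"
    and f_closed: "x \<in> carrier S \<Longrightarrow> f x \<in> carrier T"
    and g_closed: "t \<in> carrier T \<Longrightarrow> g t \<in> carrier S"
    and g_f: "x \<in> carrier S \<Longrightarrow> g (f x) = x"
    and f_g: "t \<in> carrier T \<Longrightarrow> f (g t) = t"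
    and le_iff: "\<lbrakk>x \<in> carrier S; y \<in> carrier S\<rbrakk> \<Longrightarrow> f x \<sqsubseteq>\<^bsub>T\<^esub> f y \<longleftrightarrow> x \<sqsubseteq>\<^bsub>S\<^esub> y"
    and zero_S: "ozero S \<in> carrier S"
    and f_zero: "f (ozero S) = ozero T"
    and add_S: "\<lbrakk>x \<in> carrier S; y \<in> carrier S\<rbrakk> \<Longrightarrow> x \<boxplus>\<^bsub>S\<^esub> y \<in> carrier S"
    and f_add: "\<lbrakk>x \<in> carrier S; y \<in> carrier S\<rbrakk> \<Longrightarrow> f (x \<boxplus>\<^bsub>S\<^esub> y) = f x \<boxplus>\<^bsub>T\<^esub> f y"
begin

lemma iso_sym: "ordered_monoid_iso T S g f"
proof (rule ordered_monoid_iso.intro)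
  fix x y assume xy: "x \<in> carrier T" "y \<in> carrier T"
  show "(g x \<sqsubseteq>\<^bsub>S\<^esub> g y) = (x \<sqsubseteq>\<^bsub>T\<^esub> y)"
    using le_iff[of "g x" "g y"] xy by (simp add: g_closed f_g)
  have "f (g x \<boxplus>\<^bsub>S\<^esub> g y) = x \<boxplus>\<^bsub>T\<^esub> y"
    using xy by (simp add: f_add g_closed f_g)
  moreover have c: "g x \<boxplus>\<^bsub>S\<^esub> g y \<in> carrier S"
    using xy by (simp add: add_S g_closed)
  ultimately show "x \<boxplus>\<^bsub>T\<^esub> y \<in> carrier T" "g (x \<boxplus>\<^bsub>T\<^esub> y) = g x \<boxplus>\<^bsub>S\<^esub> g y"
    using f_closed g_f by metis+
next
  show "ozero T \<in> carrier T" "g (ozero T) = ozero S"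
    using f_closed[OF zero_S] g_f[OF zero_S] f_zero by simp_all
qed (simp_all add: partial_order_S partial_order_T f_closed g_closed f_g g_f)

lemma carrier_T: "carrier T = f ` carrier S"
  using f_closed g_closed f_g by force

lemma f_inj: "\<lbrakk>x \<in> carrier S; y \<in> carrier S\<rbrakk> \<Longrightarrow> f x = f y \<longleftrightarrow> x = y"
  using g_f by metis

lemma image_f_g: "A \<subseteq> carrier T \<Longrightarrow> f ` g ` A = A"
  using f_g by (force simp: subset_iff image_iff)

lemma Upper_iso: "A \<subseteq> carrier S \<Longrightarrow> Upper T (f ` A) = f ` Upper S A"
  using image_mono[of A "carrier S" f]
  by (auto simp: Upper_eq carrier_T le_iff subset_iff)

lemma Lower_iso: "A \<subseteq> carrier S \<Longrightarrow> Lower T (f ` A) = f ` Lower S A"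
  using image_mono[of A "carrier S" f]
  by (auto simp: Lower_eq carrier_T le_iff subset_iff)

lemma f_in_image: "\<lbrakk>x \<in> carrier S; A \<subseteq> carrier S\<rbrakk> \<Longrightarrow> f x \<in> f ` A \<longleftrightarrow> x \<in> A"
  using f_inj by (auto simp: subset_iff)

lemma least_iso:
  "\<lbrakk>x \<in> carrier S; A \<subseteq> carrier S\<rbrakk> \<Longrightarrow> least T (f x) (f ` A) \<longleftrightarrow> least S x A"
  unfolding least_def carrier_T using f_in_image[of x A]
  by (auto simp: le_iff subset_iff image_mono)

lemma greatest_iso:
  "\<lbrakk>x \<in> carrier S; A \<subseteq> carrier S\<rbrakk> \<Longrightarrow> greatest T (f x) (f ` A) \<longleftrightarrow> greatest S x A"
  unfolding greatest_def carrier_T using f_in_image[of x A]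
  by (auto simp: le_iff subset_iff image_mono)

lemma lub_iso:
  "\<lbrakk>s \<in> carrier S; A \<subseteq> carrier S\<rbrakk> \<Longrightarrow> is_lub T (f s) (f ` A) \<longleftrightarrow> is_lub S s A"
  by (simp add: Upper_iso least_iso)

lemma glb_iso:
  "\<lbrakk>s \<in> carrier S; A \<subseteq> carrier S\<rbrakk> \<Longrightarrow> is_glb T (f s) (f ` A) \<longleftrightarrow> is_glb S s A"
  by (simp add: Lower_iso greatest_iso)

lemma seq_sup_iso:
  "\<lbrakk>s \<in> carrier S; \<And>n. z n \<in> carrier S\<rbrakk> \<Longrightarrow> is_seq_sup T (f s) (\<lambda>n. f (z n)) \<longleftrightarrow> is_seq_sup S s z"
  using lub_iso[of s "range z"] by (simp add: image_subset_iff image_image)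

lemma increasing_iso: "increasing S z \<Longrightarrow> increasing T (\<lambda>n. f (z n))"
  by (simp add: increasing_def f_closed le_iff)

text \<open>A test sequence in \<open>T\<close> is pulled back along \<open>g\<close>; the index
  found in \<open>S\<close> also works in \<open>T\<close>.\<close>

lemma way_below_iso_imp:
  assumes "way_below S x y"
  shows "way_below T (f x) (f y)"
  unfolding way_below_def
proof (intro conjI allI impI)
  interpret I: ordered_monoid_iso T S g f
    by (rule iso_sym)
  show xy: "f x \<in> carrier T" "f y \<in> carrier T"
    using assms by (auto simp: way_below_def f_closed)
  fix z s assume z: "increasing T z \<and> is_seq_sup T s z \<and> f y \<sqsubseteq>\<^bsub>T\<^esub> s"
  then have zc: "z n \<in> carrier T" and sc: "s \<in> carrier T" for n
    by (auto simp: increasing_def)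
  have "increasing S (\<lambda>n. g (z n))" "is_seq_sup S (g s) (\<lambda>n. g (z n))"
    using z zc sc by (auto simp: I.increasing_iso I.seq_sup_iso)
  moreover have "y \<sqsubseteq>\<^bsub>S\<^esub> g s"
    using z I.le_iff[OF xy(2) sc] g_f assms by (simp add: way_below_def)
  ultimately obtain n where "x \<sqsubseteq>\<^bsub>S\<^esub> g (z n)"
    using assms unfolding way_below_def by blast
  then show "\<exists>n. f x \<sqsubseteq>\<^bsub>T\<^esub> z n"
    using I.le_iff[OF xy(1) zc[of n]] g_f assms by (auto simp: way_below_def)
qed

lemma way_below_iso:
  assumes "x \<in> carrier S" "y \<in> carrier S"
  shows "way_below T (f x) (f y) \<longleftrightarrow> way_below S x y"
proof -
  interpret I: ordered_monoid_iso T S g f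
    by (rule iso_sym)
  show ?thesis
    using way_below_iso_imp[of x y] I.way_below_iso_imp[of "f x" "f y"] assms by (auto simp: g_f)
qed

lemma positively_ordered_monoid_iso:
  assumes "positively_ordered_monoid S"
  shows "positively_ordered_monoid T"
proof -
  interpret S: positively_ordered_monoid S
    by (rule assms)
  interpret T: partial_order T
    by (rule partial_order_T)
  have "comm_monoid (monoid_of T)"
  proof (rule comm_monoidI)
    show "x \<otimes>\<^bsub>monoid_of T\<^esub> y = y \<otimes>\<^bsub>monoid_of T\<^esub> x"
      if "x \<in> carrier (monoid_of T)" "y \<in> carrier (monoid_of T)" for x y
      using that by (auto simp: monoid_of_def carrier_T f_add[symmetric] S.oplus_comm)
  qed (auto simp: monoid_of_def carrier_T f_add[symmetric] f_zero[symmetric] S.oplus_assoc)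
  moreover have "x \<boxplus>\<^bsub>T\<^esub> y \<sqsubseteq>\<^bsub>T\<^esub> x' \<boxplus>\<^bsub>T\<^esub> y'"
    if "x \<in> carrier T" "x' \<in> carrier T" "y \<in> carrier T" "y' \<in> carrier T"
      "x \<sqsubseteq>\<^bsub>T\<^esub> x'" "y \<sqsubseteq>\<^bsub>T\<^esub> y'" for x x' y y'
    using that unfolding carrier_T by (auto simp: le_iff f_add[symmetric] intro!: S.add_mono)
  moreover have "ozero T \<sqsubseteq>\<^bsub>T\<^esub> x" if "x \<in> carrier T" for x
    using that unfolding carrier_T by (auto simp: le_iff f_zero[symmetric] S.zero_le)
  ultimately show ?thesis
    by (intro positively_ordered_monoid.intro positively_ordered_monoid_axioms.intro
        partial_order_T)
qed

text \<open>Through this transport the function monoid \<open>Lsc hull_kernel\<close> receives (O1)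
  to (O4) from \<open>S\<close>; they are never verified on functions.\<close>

lemma cu_semigroup_iso:
  assumes "cu_semigroup S"
  shows "cu_semigroup T"
proof -
  interpret S: cu_semigroup S
    by (rule assms)
  interpret T: positively_ordered_monoid T
    by (rule positively_ordered_monoid_iso[OF S.positively_ordered_monoid_axioms])
  interpret I: ordered_monoid_iso T S g f
    by (rule iso_sym)
  show ?thesis
  proof
    fix z assume z: "increasing T z"
    then have zc: "z n \<in> carrier T" for n
      by (rule T.increasing_closed)
    obtain s where s: "is_seq_sup S s (\<lambda>n. g (z n))"
      using S.O1 I.increasing_iso[OF z] by blast
    then have "is_seq_sup T (f s) z"
      using seq_sup_iso[of s "\<lambda>n. g (z n)"] zc by (auto simp: g_closed f_g)
    then show "\<exists>s. is_seq_sup T s z"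
      by blast
  next
    fix x assume "x \<in> carrier T"
    then obtain x' where x': "x = f x'" "x' \<in> carrier S"
      unfolding carrier_T by blast
    obtain z where z: "\<And>n. way_below S (z n) (z (Suc n))" "is_seq_sup S x' z"
      using S.O2[OF x'(2)] by blast
    have zc: "z n \<in> carrier S" for n
      using z(1)[of n] by (simp add: way_below_def)
    have "\<forall>n. way_below T (f (z n)) (f (z (Suc n)))" "is_seq_sup T x (\<lambda>n. f (z n))"
      using z x' zc by (simp_all add: way_below_iso seq_sup_iso)
    then show "\<exists>z. (\<forall>n. way_below T (z n) (z (Suc n))) \<and> is_seq_sup T x z"
      by (intro exI[of _ "\<lambda>n. f (z n)"]) simp
  next
    fix x' x y' y assume *: "way_below T x' x" "way_below T y' y"
    have "way_below S (g x' \<boxplus>\<^bsub>S\<^esub> g y') (g x \<boxplus>\<^bsub>S\<^esub> g y)"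
      by (intro S.O3 I.way_below_iso_imp *)
    from way_below_iso_imp[OF this]
    have "way_below T (f (g x' \<boxplus>\<^bsub>S\<^esub> g y')) (f (g x \<boxplus>\<^bsub>S\<^esub> g y))" .
    moreover have "x' \<in> carrier T" "y' \<in> carrier T" "x \<in> carrier T" "y \<in> carrier T"
      using * by (simp_all add: way_below_def)
    ultimately show "way_below T (x' \<boxplus>\<^bsub>T\<^esub> y') (x \<boxplus>\<^bsub>T\<^esub> y)"
      by (simp add: f_add g_closed f_g)
  next
    fix u v s t
    assume *: "increasing T u" "increasing T v" "is_seq_sup T s u" "is_seq_sup T t v"
    then have c: "u n \<in> carrier T" "v n \<in> carrier T" "s \<in> carrier T" "t \<in> carrier T" for n
      by (simp_all add: T.increasing_closed)
    have "is_seq_sup S (g s \<boxplus>\<^bsub>S\<^esub> g t) (\<lambda>n. g (u n) \<boxplus>\<^bsub>S\<^esub> g (v n))"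
      using * c by (intro S.O4) (simp_all add: I.increasing_iso I.seq_sup_iso)
    then show "is_seq_sup T (s \<boxplus>\<^bsub>T\<^esub> t) (\<lambda>n. u n \<boxplus>\<^bsub>T\<^esub> v n)"
      using seq_sup_iso[of "g s \<boxplus>\<^bsub>S\<^esub> g t" "\<lambda>n. g (u n) \<boxplus>\<^bsub>S\<^esub> g (v n)"] c
      by (simp add: g_closed f_g f_add)
  qed
qed

lemma cu_morphism_f:
  "cu_morphism S T f"
  unfolding cu_morphism_def
  by (auto simp: f_closed le_iff f_add f_zero way_below_iso_imp seq_sup_iso increasing_def)

lemma cu_isomorphic_iso:
  assumes "cu_semigroup S"
  shows "cu_isomorphic S T"
proof -
  interpret I: ordered_monoid_iso T S g f
    by (rule iso_sym)
  show ?thesis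
    unfolding cu_isomorphic_def
    using assms cu_semigroup_iso cu_morphism_f I.cu_morphism_f g_f f_g by blast
qed

lemma sup_complete_iso:
  assumes "sup_complete S"
  shows "sup_complete T"
  unfolding sup_complete_def
proof (intro allI impI)
  fix A assume A: "A \<subseteq> carrier T"
  then have c: "g ` A \<subseteq> carrier S"
    using g_closed by blast
  then obtain s where "is_lub S s (g ` A)"
    using assms unfolding sup_complete_def by blast
  then have "is_lub T (f s) A"
    using lub_iso[of s "g ` A"] c by (simp add: image_f_g[OF A])
  then show "\<exists>s. is_lub T s A"
    by blast
qed

lemma lattice_iso:
  assumes "lattice S"
  shows "lattice T"
proof -
  interpret S: lattice S
    by (rule assms)
  interpret T: partial_order T
    by (rule partial_order_T)
  show ?thesis
  proof
    fix x y assume xy: "x \<in> carrier T" "y \<in> carrier T"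
    have im: "f ` {g x, g y} = {x, y}" and gc: "g x \<in> carrier S" "g y \<in> carrier S"
      using xy by (simp_all add: f_g g_closed)
    show "\<exists>s. is_lub T s {x, y}"
      using S.sup_of_two_exists[OF gc] lub_iso[of _ "{g x, g y}"] im gc least_closed
      by (metis empty_subsetI insert_subset)
    show "\<exists>s. is_glb T s {x, y}"
      using S.inf_of_two_exists[OF gc] glb_iso[of _ "{g x, g y}"] im gc greatest_closed
      by (metis empty_subsetI insert_subset)
  qed
qed

text \<open>Bounds are preserved, and least upper and greatest lower bounds in a partial order are
  unique.\<close>

lemma f_join_meet:
  assumes "lattice S" and xy: "x \<in> carrier S" "y \<in> carrier S"
  shows "f (x \<squnion>\<^bsub>S\<^esub> y) = f x \<squnion>\<^bsub>T\<^esub> f y" "f (x \<sqinter>\<^bsub>S\<^esub> y) = f x \<sqinter>\<^bsub>T\<^esub> f y"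
proof -
  interpret S: lattice S
    by (rule assms)
  interpret T: lattice T
    by (rule lattice_iso[OF assms(1)])
  have "is_lub S (x \<squnion>\<^bsub>S\<^esub> y) {x, y}" "is_glb S (x \<sqinter>\<^bsub>S\<^esub> y) {x, y}"
    using xy by (auto simp: join_def meet_def intro: S.sup_of_two_least S.inf_of_two_greatest)
  then have "is_lub T (f (x \<squnion>\<^bsub>S\<^esub> y)) {f x, f y}" "is_glb T (f (x \<sqinter>\<^bsub>S\<^esub> y)) {f x, f y}"
    using lub_iso[of "x \<squnion>\<^bsub>S\<^esub> y" "{x, y}"] glb_iso[of "x \<sqinter>\<^bsub>S\<^esub> y" "{x, y}"] xy by simp_all
  moreover have "is_lub T (f x \<squnion>\<^bsub>T\<^esub> f y) {f x, f y}" "is_glb T (f x \<sqinter>\<^bsub>T\<^esub> f y) {f x, f y}"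
    using xy by (auto simp: join_def meet_def f_closed
        intro: T.sup_of_two_least T.inf_of_two_greatest)
  ultimately show "f (x \<squnion>\<^bsub>S\<^esub> y) = f x \<squnion>\<^bsub>T\<^esub> f y" "f (x \<sqinter>\<^bsub>S\<^esub> y) = f x \<sqinter>\<^bsub>T\<^esub> f y"
    using T.least_unique T.greatest_unique by blast+
qed

lemma distributively_lattice_ordered_iso:
  assumes "distributively_lattice_ordered S"
  shows "distributively_lattice_ordered T"
proof -
  have l: "lattice S"
    using assms by (simp add: distributively_lattice_ordered_def)
  interpret S: lattice S
    by (rule l)
  have *: "f x \<boxplus>\<^bsub>T\<^esub> f y = (f x \<squnion>\<^bsub>T\<^esub> f y) \<boxplus>\<^bsub>T\<^esub> (f x \<sqinter>\<^bsub>T\<^esub> f y)"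
    if "x \<in> carrier S" "y \<in> carrier S" for x y
  proof -
    have "x \<boxplus>\<^bsub>S\<^esub> y = (x \<squnion>\<^bsub>S\<^esub> y) \<boxplus>\<^bsub>S\<^esub> (x \<sqinter>\<^bsub>S\<^esub> y)"
      using assms that unfolding distributively_lattice_ordered_def by blast
    then have "f (x \<boxplus>\<^bsub>S\<^esub> y) = f ((x \<squnion>\<^bsub>S\<^esub> y) \<boxplus>\<^bsub>S\<^esub> (x \<sqinter>\<^bsub>S\<^esub> y))"
      by (rule arg_cong)
    then show ?thesis
      using that by (simp add: f_add f_join_meet[OF l])
  qed
  have **: "f x \<sqinter>\<^bsub>T\<^esub> (f y \<squnion>\<^bsub>T\<^esub> f z) = (f x \<sqinter>\<^bsub>T\<^esub> f y) \<squnion>\<^bsub>T\<^esub> (f x \<sqinter>\<^bsub>T\<^esub> f z)"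
    if "x \<in> carrier S" "y \<in> carrier S" "z \<in> carrier S" for x y z
    using assms that by (simp add: distributively_lattice_ordered_def f_join_meet[OF l, symmetric])
  show ?thesis
    unfolding distributively_lattice_ordered_def carrier_T ball_simps
    by (intro conjI lattice_iso[OF l] ballI * **)
qed

lemma idempotents_iso: "idempotents T = f ` idempotents S"
  by (auto simp: idempotents_def carrier_T f_add[symmetric] f_inj add_S)

lemma maximal_idempotents_iso: "maximal_idempotents T = f ` maximal_idempotents S"
proof -
  have "greatest T (f x) (carrier T) \<longleftrightarrow> greatest S x (carrier S)" if "x \<in> idempotents S" for x
    using that greatest_iso[of x "carrier S"] by (simp add: carrier_T idempotents_def)
  moreover have "idempotents S \<subseteq> carrier S"
    by (auto simp: idempotents_def)
  ultimately show ?thesis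
    unfolding maximal_idempotents_def idempotents_iso
    by (auto simp: le_iff f_inj subset_iff)
qed

lemma condition_C1_iso:
  assumes "condition_C1 S"
  shows "condition_C1 T"
proof -
  have c: "idempotents S \<subseteq> carrier S" "maximal_idempotents S \<subseteq> carrier S"
    by (auto simp: idempotents_def maximal_idempotents_def)
  have *: "{x \<in> maximal_idempotents T. f y \<sqsubseteq>\<^bsub>T\<^esub> x} = f ` {x \<in> maximal_idempotents S. y \<sqsubseteq>\<^bsub>S\<^esub> x}"
    if "y \<in> carrier S" for y
    using that c unfolding maximal_idempotents_iso by (auto simp: le_iff subset_iff)
  have "f ` A \<subseteq> f ` B \<longleftrightarrow> A \<subseteq> B" if "A \<subseteq> carrier S" "B \<subseteq> carrier S" for A B
    using that f_in_image by blast
  then have **: "f ` {x \<in> maximal_idempotents S. P x} \<subseteq> f ` {x \<in> maximal_idempotents S. Q x}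
      \<longleftrightarrow> {x \<in> maximal_idempotents S. P x} \<subseteq> {x \<in> maximal_idempotents S. Q x}" for P Q
    using c(2) by (simp add: Collect_conj_eq inf.coboundedI1)
  show ?thesis
    unfolding condition_C1_def idempotents_iso
  proof (intro ballI, clarsimp)
    fix y z assume yz: "y \<in> idempotents S" "z \<in> idempotents S"
    then have "y \<in> carrier S" "z \<in> carrier S"
      using c by auto
    then show "(f z \<sqsubseteq>\<^bsub>T\<^esub> f y) = ({x \<in> maximal_idempotents T. f y \<sqsubseteq>\<^bsub>T\<^esub> x}
        \<subseteq> {x \<in> maximal_idempotents T. f z \<sqsubseteq>\<^bsub>T\<^esub> x})"
      using assms yz unfolding condition_C1_def by (simp add: * ** le_iff)
  qed
qed

lemma f_osum:
  assumes "positively_ordered_monoid S" "\<And>i. i < n \<Longrightarrow> x i \<in> carrier S"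
  shows "f (osum S x n) = osum T (\<lambda>i. f (x i)) n"
proof -
  interpret S: positively_ordered_monoid S
    by (rule assms)
  interpret T: positively_ordered_monoid T
    by (rule positively_ordered_monoid_iso[OF assms(1)])
  show ?thesis
    using assms(2) by (induction n) (simp_all add: f_zero S.osum_Suc T.osum_Suc f_add f_closed)
qed

lemma down_set_iso: "e \<in> carrier S \<Longrightarrow> down_set T (f e) = f ` down_set S e"
  by (auto simp: down_set_def carrier_T le_iff)

lemma finite_sums_iso:
  assumes "positively_ordered_monoid S" "H \<subseteq> carrier S"
  shows "f ` finite_sums S H \<subseteq> finite_sums T (f ` H)"
proof clarify
  fix y assume "y \<in> finite_sums S H"
  then obtain x m where y: "y = osum S x m" "\<forall>i<m. x i \<in> H"
    by (auto simp: finite_sums_def)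
  then have "f y = osum T (\<lambda>i. f (x i)) m"
    using f_osum[OF assms(1), of m x] assms(2) by auto
  then show "f y \<in> finite_sums T (f ` H)"
    using y(2) by (auto simp: finite_sums_def)
qed

lemma topological_subset_iso:
  assumes "positively_ordered_monoid S" "topological_subset S H"
  shows "topological_subset T (f ` H)"
  unfolding topological_subset_def
proof (intro conjI allI impI)
  interpret I: ordered_monoid_iso T S g f
    by (rule iso_sym)
  interpret S: positively_ordered_monoid S
    by (rule assms)
  have H: "H \<subseteq> carrier S"
    using assms(2) by (simp add: topological_subset_def)
  then show "f ` H \<subseteq> carrier T"
    using f_closed by auto
  fix m x y
  assume *: "finite_increasing_in T (f ` H) m x \<and> finite_increasing_in T (f ` H) m y"
  have c: "x i \<in> carrier T" "y i \<in> carrier T" if "i < m" for i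
    using * that image_mono[OF H, of f] by (auto simp: finite_increasing_in_def carrier_T)
  have "finite_increasing_in S H m (\<lambda>i. g (w i))" if "finite_increasing_in T (f ` H) m w" for w
  proof -
    have w: "w i \<in> f ` H" if "i < m" for i
      using \<open>finite_increasing_in T (f ` H) m w\<close> that by (simp add: finite_increasing_in_def)
    have gw: "g (w i) \<in> H \<and> w i \<in> carrier T" if i: "i < m" for i
    proof -
      obtain h where "h \<in> H" "w i = f h"
        using w[OF i] by blast
      then show ?thesis
        using H g_f f_closed by (simp add: subset_iff)
    qed
    have "w i \<sqsubseteq>\<^bsub>T\<^esub> w (Suc i)" if "Suc i < m" for i
      using \<open>finite_increasing_in T (f ` H) m w\<close> that by (simp add: finite_increasing_in_def)
    then show ?thesis
      using gw by (simp add: finite_increasing_in_def I.le_iff)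
  qed
  then have "osum S (\<lambda>i. g (x i)) m \<sqsubseteq>\<^bsub>S\<^esub> osum S (\<lambda>i. g (y i)) m \<longleftrightarrow>
      (\<forall>i<m. g (x i) \<sqsubseteq>\<^bsub>S\<^esub> g (y i))"
    using * assms(2) unfolding topological_subset_def by blast
  moreover have "osum T x m \<in> carrier T" "osum T y m \<in> carrier T"
    "g (osum T x m) = osum S (\<lambda>i. g (x i)) m" "g (osum T y m) = osum S (\<lambda>i. g (y i)) m"
    using I.f_osum positively_ordered_monoid_iso[OF assms(1)] c
      positively_ordered_monoid.osum_closed by blast+
  ultimately show "osum T x m \<sqsubseteq>\<^bsub>T\<^esub> osum T y m \<longleftrightarrow> (\<forall>i<m. x i \<sqsubseteq>\<^bsub>T\<^esub> y i)"
    using I.le_iff c by metis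
qed

lemma condition_C2_iso:
  assumes "positively_ordered_monoid S" "condition_C2 S"
  shows "condition_C2 T"
proof -
  interpret I: ordered_monoid_iso T S g f
    by (rule iso_sym)
  obtain e where e: "e \<in> carrier S" "topological_subset S (down_set S e)"
    "sup_dense S (finite_sums S (down_set S e))"
    using assms(2) unfolding condition_C2_def by blast
  have "sup_dense T (finite_sums T (f ` down_set S e))"
    unfolding sup_dense_def
  proof
    fix s assume s: "s \<in> carrier T"
    then obtain z where z: "increasing S z" "range z \<subseteq> finite_sums S (down_set S e)"
        "is_seq_sup S (g s) z"
      using e(3) g_closed unfolding sup_dense_def by blast
    have "increasing T (\<lambda>n. f (z n))" "is_seq_sup T s (\<lambda>n. f (z n))"
      using z increasing_iso[OF z(1)] seq_sup_iso[of "g s" z] s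
      by (simp_all add: g_closed f_g increasing_def)
    moreover have "range (\<lambda>n. f (z n)) \<subseteq> finite_sums T (f ` down_set S e)"
      using finite_sums_iso[OF assms(1), of "down_set S e"] z(2) by (force simp: down_set_def)
    ultimately show "\<exists>z. increasing T z \<and> range z \<subseteq> finite_sums T (f ` down_set S e)
        \<and> is_seq_sup T s z"
      by blast
  qed
  then show ?thesis
    unfolding condition_C2_def
    using topological_subset_iso[OF assms(1) e(2)] f_closed[OF e(1)] down_set_iso[OF e(1)]
    by metis
qed

end

text \<open>A \<open>Cu\<close>-morphism is only required to be monotone; that \<open>f\<close> also
  reflects the order comes from applying the monotone inverse \<open>g\<close> to \<open>f x\<close>
  and \<open>f y\<close>.\<close>

lemma cu_isomorphic_imp_iso:
  assumes "cu_isomorphic S T"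
  obtains f g where "ordered_monoid_iso S T f g"
proof -
  obtain f g where fg: "cu_morphism S T f" "cu_morphism T S g"
      "\<forall>x\<in>carrier S. g (f x) = x" "\<forall>y\<in>carrier T. f (g y) = y"
      "cu_semigroup S" "cu_semigroup T"
    using assms unfolding cu_isomorphic_def by blast
  interpret S: cu_semigroup S
    by fact
  interpret T: cu_semigroup T
    by fact
  have "f x \<sqsubseteq>\<^bsub>T\<^esub> f y \<longleftrightarrow> x \<sqsubseteq>\<^bsub>S\<^esub> y" if "x \<in> carrier S" "y \<in> carrier S" for x y
    using that fg unfolding cu_morphism_def by (metis funcset_mem)
  then have "ordered_monoid_iso S T f g"
    using fg S.partial_order_axioms T.partial_order_axioms unfolding cu_morphism_def
    by unfold_locales (auto simp: S.partial_order_axioms T.partial_order_axioms)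
  then show ?thesis
    by (rule that)
qed

section \<open>Lower semicontinuous functions\<close>

text \<open>A supremum of extended naturals that reaches a positive finite bound reaches it at some
  member. For the bound 0 this fails when \<open>A\<close> is empty, hence
  \<open>Suc m\<close>.\<close>

lemma enat_Suc_le_SUP_iff: "enat (Suc m) \<le> (SUP i\<in>A. f i) \<longleftrightarrow> (\<exists>i\<in>A. enat (Suc m) \<le> f i)"
  by (simp add: Suc_ile_eq less_SUP_iff)

text \<open>If \<open>b < a\<close>, then \<open>b\<close> is finite and the threshold
  \<open>b + 1\<close> separates the two, so positive finite thresholds suffice.\<close>

lemma enat_le_cases: "(\<And>n. enat (Suc n) \<le> a \<Longrightarrow> enat (Suc n) \<le> b) \<Longrightarrow> a \<le> (b :: enat)"
proof (rule ccontr)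
  assume *: "\<And>n. enat (Suc n) \<le> a \<Longrightarrow> enat (Suc n) \<le> b" and "\<not> a \<le> b"
  then have "b < a"
    by simp
  then obtain k where "b = enat k"
    by (cases b) auto
  then show False
    using *[of k] \<open>b < a\<close> by (simp add: Suc_ile_eq)
qed

lemma Lsc_simps:
  "x \<sqsubseteq>\<^bsub>Lsc X\<^esub> y \<longleftrightarrow> (\<forall>p\<in>topspace X. x p \<le> y p)"
  "x \<boxplus>\<^bsub>Lsc X\<^esub> y = (\<lambda>p\<in>topspace X. x p + y p)"
  "ozero (Lsc X) = (\<lambda>p\<in>topspace X. 0)"
  by (simp_all add: Lsc_def)

text \<open>The superlevel set at 0 is the whole space. Indexing the other thresholds by
  \<open>Suc n\<close> matches the coefficient sequences, whose index 0 belongs to threshold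
  1.\<close>

lemma Lsc_carrier_iff:
  "f \<in> carrier (Lsc X) \<longleftrightarrow>
    f \<in> extensional (topspace X) \<and> (\<forall>n. openin X {x \<in> topspace X. enat (Suc n) \<le> f x})"
proof -
  have "openin X {x \<in> topspace X. enat 0 \<le> f x}"
    by (simp add: enat_0)
  then have "(\<forall>n. openin X {x \<in> topspace X. enat n \<le> f x}) \<longleftrightarrow>
      (\<forall>n. openin X {x \<in> topspace X. enat (Suc n) \<le> f x})"
    by (metis not0_implies_Suc)
  then show ?thesis
    by (simp add: Lsc_def PiE_def)
qed

lemma Lsc_openin: "f \<in> carrier (Lsc X) \<Longrightarrow> openin X {x \<in> topspace X. enat n \<le> f x}"
  by (simp add: Lsc_def)

lemma Lsc_eqI:
  assumes "f \<in> carrier (Lsc X)" "g \<in> carrier (Lsc X)" "\<And>p. p \<in> topspace X \<Longrightarrow> f p = g p"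
  shows "f = g"
  using assms by (auto simp: Lsc_carrier_iff intro: extensionalityI)

lemma partial_order_Lsc: "partial_order (Lsc X)"
proof
  fix x y assume "x \<sqsubseteq>\<^bsub>Lsc X\<^esub> y" "y \<sqsubseteq>\<^bsub>Lsc X\<^esub> x" "x \<in> carrier (Lsc X)" "y \<in> carrier (Lsc X)"
  then have "x = y"
    by (intro Lsc_eqI[of x X y]) (auto simp: Lsc_simps intro: antisym)
  then show "x .=\<^bsub>Lsc X\<^esub> y"
    by (simp add: Lsc_def)
next
  fix x y z assume "x \<sqsubseteq>\<^bsub>Lsc X\<^esub> y" "y \<sqsubseteq>\<^bsub>Lsc X\<^esub> z"
  then show "x \<sqsubseteq>\<^bsub>Lsc X\<^esub> z"
    by (auto simp: Lsc_simps intro: order_trans)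
qed (auto simp: Lsc_def)

text \<open>Superlevel sets of a pointwise supremum at positive thresholds are unions of open
  sets.\<close>

lemma Lsc_lub_SUP:
  assumes A: "A \<subseteq> carrier (Lsc X)"
  shows "is_lub (Lsc X) (\<lambda>p\<in>topspace X. SUP f\<in>A. f p) A"
proof -
  define s where "s = (\<lambda>p\<in>topspace X. SUP f\<in>A. f p)"
  have "openin X {x \<in> topspace X. enat (Suc n) \<le> s x}" for n
  proof -
    have "{x \<in> topspace X. enat (Suc n) \<le> s x} = (\<Union>f\<in>A. {x \<in> topspace X. enat (Suc n) \<le> f x})"
      by (auto simp: s_def enat_Suc_le_SUP_iff)
    moreover have "openin X (\<Union>f\<in>A. {x \<in> topspace X. enat (Suc n) \<le> f x})"
      using A by (intro openin_Union) (auto intro: Lsc_openin)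
    ultimately show ?thesis
      by simp
  qed
  then have "s \<in> carrier (Lsc X)"
    by (simp add: Lsc_carrier_iff s_def)
  then have "is_lub (Lsc X) s A"
    using A by (auto simp: is_lub_iff Lsc_simps s_def intro: SUP_upper intro!: SUP_least)
  then show ?thesis
    by (simp add: s_def)
qed

lemma sup_complete_Lsc: "sup_complete (Lsc X)"
  unfolding sup_complete_def using Lsc_lub_SUP by blast

lemma Lsc_max_min_closed:
  assumes "f \<in> carrier (Lsc X)" "g \<in> carrier (Lsc X)"
  shows "(\<lambda>p\<in>topspace X. max (f p) (g p)) \<in> carrier (Lsc X)" (is "?max \<in> _")
    and "(\<lambda>p\<in>topspace X. min (f p) (g p)) \<in> carrier (Lsc X)" (is "?min \<in> _")
proof -
  have "{x \<in> topspace X. enat n \<le> ?max x} =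
      {x \<in> topspace X. enat n \<le> f x} \<union> {x \<in> topspace X. enat n \<le> g x}"
    and "{x \<in> topspace X. enat n \<le> ?min x} =
      {x \<in> topspace X. enat n \<le> f x} \<inter> {x \<in> topspace X. enat n \<le> g x}" for n
    by (auto simp: le_max_iff_disj)
  then show "?max \<in> carrier (Lsc X)" "?min \<in> carrier (Lsc X)"
    using assms by (simp_all add: Lsc_carrier_iff openin_Un openin_Int)
qed

lemma Lsc_lub_max:
  assumes "f \<in> carrier (Lsc X)" "g \<in> carrier (Lsc X)"
  shows "is_lub (Lsc X) (\<lambda>p\<in>topspace X. max (f p) (g p)) {f, g}"
  using assms Lsc_max_min_closed[OF assms] by (simp add: is_lub_iff Lsc_simps)

lemma Lsc_glb_min:
  assumes "f \<in> carrier (Lsc X)" "g \<in> carrier (Lsc X)"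
  shows "is_glb (Lsc X) (\<lambda>p\<in>topspace X. min (f p) (g p)) {f, g}"
  using assms Lsc_max_min_closed[OF assms] by (simp add: is_glb_iff Lsc_simps)

lemma lattice_Lsc: "lattice (Lsc X)"
proof -
  interpret partial_order "Lsc X"
    by (rule partial_order_Lsc)
  show ?thesis
    by unfold_locales (rule exI, rule Lsc_lub_max Lsc_glb_min; assumption)+
qed

lemma Lsc_join_meet:
  assumes "f \<in> carrier (Lsc X)" "g \<in> carrier (Lsc X)"
  shows "f \<squnion>\<^bsub>Lsc X\<^esub> g = (\<lambda>p\<in>topspace X. max (f p) (g p))"
    and "f \<sqinter>\<^bsub>Lsc X\<^esub> g = (\<lambda>p\<in>topspace X. min (f p) (g p))"
proof -
  interpret lattice "Lsc X"
    by (rule lattice_Lsc)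
  have "is_lub (Lsc X) (f \<squnion>\<^bsub>Lsc X\<^esub> g) {f, g}"
    by (rule joinI[OF _ assms])
  then show "f \<squnion>\<^bsub>Lsc X\<^esub> g = (\<lambda>p\<in>topspace X. max (f p) (g p))"
    using Lsc_lub_max[OF assms] by (rule least_unique)
  have "is_glb (Lsc X) (f \<sqinter>\<^bsub>Lsc X\<^esub> g) {f, g}"
    by (rule meetI[OF _ assms])
  then show "f \<sqinter>\<^bsub>Lsc X\<^esub> g = (\<lambda>p\<in>topspace X. min (f p) (g p))"
    using Lsc_glb_min[OF assms] by (rule greatest_unique)
qed

lemma distributively_lattice_ordered_Lsc: "distributively_lattice_ordered (Lsc X)"
proof -
  have "x \<sqinter>\<^bsub>Lsc X\<^esub> (y \<squnion>\<^bsub>Lsc X\<^esub> z) = (x \<sqinter>\<^bsub>Lsc X\<^esub> y) \<squnion>\<^bsub>Lsc X\<^esub> (x \<sqinter>\<^bsub>Lsc X\<^esub> z)"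
    if "x \<in> carrier (Lsc X)" "y \<in> carrier (Lsc X)" "z \<in> carrier (Lsc X)" for x y z
  proof -
    note c = that Lsc_max_min_closed[OF that(2,3)] Lsc_max_min_closed[OF that(1,2)]
      Lsc_max_min_closed[OF that(1,3)]
    show ?thesis
      by (simp add: Lsc_join_meet c min_max_distrib2 cong: restrict_cong)
  qed
  moreover have "x \<boxplus>\<^bsub>Lsc X\<^esub> y = (x \<squnion>\<^bsub>Lsc X\<^esub> y) \<boxplus>\<^bsub>Lsc X\<^esub> (x \<sqinter>\<^bsub>Lsc X\<^esub> y)"
    if "x \<in> carrier (Lsc X)" "y \<in> carrier (Lsc X)" for x y
    using that by (auto simp: Lsc_simps Lsc_join_meet max_def min_def add.commute
        intro!: restrict_ext)
  ultimately show ?thesis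
    by (auto simp only: distributively_lattice_ordered_def lattice_Lsc)
qed

section \<open>Idempotent functions and condition (C1)\<close>

text \<open>The value \<open>c\<close> is 1 for the generators in (C2) and infinity for the
  idempotents in (C1).\<close>

definition Lsc_indicator :: "'x topology \<Rightarrow> enat \<Rightarrow> 'x set \<Rightarrow> 'x \<Rightarrow> enat" where
  "Lsc_indicator X c U = (\<lambda>p\<in>topspace X. if p \<in> U then c else 0)"

lemma Lsc_indicator_closed:
  assumes "openin X U"
  shows "Lsc_indicator X c U \<in> carrier (Lsc X)"
proof -
  have "{p \<in> topspace X. enat (Suc n) \<le> Lsc_indicator X c U p} = (if enat (Suc n) \<le> c then U else {})"
    for n
    using openin_subset[OF assms] by (auto simp: Lsc_indicator_def zero_enat_def)
  then show ?thesis
    using assms by (simp add: Lsc_carrier_iff) (simp add: Lsc_indicator_def)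
qed

lemma Lsc_indicator_le_iff:
  assumes "openin X U" "c \<noteq> 0"
  shows "Lsc_indicator X c U \<sqsubseteq>\<^bsub>Lsc X\<^esub> Lsc_indicator X c V \<longleftrightarrow> U \<subseteq> V"
  using assms openin_subset[OF assms(1)] by (auto simp: Lsc_simps Lsc_indicator_def)

text \<open>Among extended naturals \<open>a + a = a\<close> leaves only 0 and infinity.\<close>

lemma Lsc_idempotent_eq_indicator:
  assumes "f \<in> idempotents (Lsc X)"
  obtains U where "openin X U" "f = Lsc_indicator X \<infinity> U"
proof
  have c: "f \<in> carrier (Lsc X)"
    using assms by (simp add: idempotents_def)
  show o: "openin X {x \<in> topspace X. enat 1 \<le> f x}"
    by (rule Lsc_openin[OF c])
  show "f = Lsc_indicator X \<infinity> {x \<in> topspace X. enat 1 \<le> f x}"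
  proof (rule Lsc_eqI[OF c Lsc_indicator_closed[OF o]])
    fix p assume p: "p \<in> topspace X"
    have "(\<lambda>p\<in>topspace X. f p + f p) p = f p"
      using assms by (simp add: idempotents_def Lsc_simps)
    then have "f p + f p = f p"
      using p by simp
    then show "f p = Lsc_indicator X \<infinity> {x \<in> topspace X. enat 1 \<le> f x} p"
      using p by (cases "f p") (auto simp: Lsc_indicator_def zero_enat_def)
  qed
qed

lemma Lsc_indicator_infty_idempotent:
  "openin X U \<Longrightarrow> Lsc_indicator X \<infinity> U \<in> idempotents (Lsc X)"
  by (simp add: idempotents_def Lsc_indicator_closed)
    (auto simp: Lsc_simps Lsc_indicator_def fun_eq_iff)

lemma Lsc_indicator_greatest:
  "greatest (Lsc X) (Lsc_indicator X \<infinity> (topspace X)) (carrier (Lsc X))"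
  by (simp add: greatest_def Lsc_indicator_closed) (simp add: Lsc_simps Lsc_indicator_def)

text \<open>\<open>T1\<close> makes the complement of a point open, and no set fits strictly between
  this complement and the whole space.\<close>

lemma Lsc_maximal_idempotent:
  assumes "t1_space X" "p \<in> topspace X"
  shows "Lsc_indicator X \<infinity> (topspace X - {p}) \<in> maximal_idempotents (Lsc X)"
proof -
  have o: "openin X (topspace X - {p})"
    using assms by (simp add: closedin_t1_singleton openin_diff)
  have "\<not> greatest (Lsc X) (Lsc_indicator X \<infinity> (topspace X - {p})) (carrier (Lsc X))"
  proof
    assume "greatest (Lsc X) (Lsc_indicator X \<infinity> (topspace X - {p})) (carrier (Lsc X))"
    then have "Lsc_indicator X \<infinity> (topspace X) \<sqsubseteq>\<^bsub>Lsc X\<^esub> Lsc_indicator X \<infinity> (topspace X - {p})"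
      by (rule greatest_le) (simp add: Lsc_indicator_closed)
    then show False
      using assms(2) by (auto simp: Lsc_indicator_le_iff)
  qed
  moreover have "y = Lsc_indicator X \<infinity> (topspace X - {p})"
    if y: "y \<in> idempotents (Lsc X)" "\<not> greatest (Lsc X) y (carrier (Lsc X))"
      "Lsc_indicator X \<infinity> (topspace X - {p}) \<sqsubseteq>\<^bsub>Lsc X\<^esub> y" for y
  proof -
    obtain U where U: "openin X U" "y = Lsc_indicator X \<infinity> U"
      by (rule Lsc_idempotent_eq_indicator[OF y(1)])
    have "topspace X - {p} \<subseteq> U" "U \<subseteq> topspace X" "U \<noteq> topspace X"
      using y U openin_subset[OF U(1)] Lsc_indicator_greatest[of X]
      by (auto simp: Lsc_indicator_le_iff[OF o])
    then have "U = topspace X - {p}"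
      by blast
    then show ?thesis
      using U by simp
  qed
  ultimately show ?thesis
    using Lsc_indicator_infty_idempotent[OF o] unfolding maximal_idempotents_def by blast
qed

lemma condition_C1_Lsc:
  assumes "t1_space X"
  shows "condition_C1 (Lsc X)"
  unfolding condition_C1_def
proof (intro ballI iffI)
  interpret partial_order "Lsc X"
    by (rule partial_order_Lsc)
  fix y z assume yz: "y \<in> idempotents (Lsc X)" "z \<in> idempotents (Lsc X)"
  then obtain U V where U: "openin X U" "z = Lsc_indicator X \<infinity> U"
      and V: "openin X V" "y = Lsc_indicator X \<infinity> V"
    using Lsc_idempotent_eq_indicator by metis
  {
    assume "z \<sqsubseteq>\<^bsub>Lsc X\<^esub> y"
    then show "{x \<in> maximal_idempotents (Lsc X). y \<sqsubseteq>\<^bsub>Lsc X\<^esub> x}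
        \<subseteq> {x \<in> maximal_idempotents (Lsc X). z \<sqsubseteq>\<^bsub>Lsc X\<^esub> x}"
      by (auto simp: Lsc_simps intro: order_trans)
  next
    assume *: "{x \<in> maximal_idempotents (Lsc X). y \<sqsubseteq>\<^bsub>Lsc X\<^esub> x}
        \<subseteq> {x \<in> maximal_idempotents (Lsc X). z \<sqsubseteq>\<^bsub>Lsc X\<^esub> x}"
    have "U \<subseteq> V"
    proof (rule ccontr)
      assume "\<not> U \<subseteq> V"
      then obtain p where p: "p \<in> U" "p \<notin> V"
        by blast
      \<comment> \<open>The maximal idempotent vanishing exactly at \<open>p\<close> lies above
        \<open>y\<close>, which vanishes at \<open>p\<close>, but not above \<open>z\<close>, which
        does not.\<close>
      define m where "m = Lsc_indicator X \<infinity> (topspace X - {p})"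
      have "m \<in> maximal_idempotents (Lsc X)"
        unfolding m_def using p openin_subset[OF U(1)] by (intro Lsc_maximal_idempotent assms) auto
      moreover have "y \<sqsubseteq>\<^bsub>Lsc X\<^esub> m"
        using p openin_subset[OF V(1)] by (auto simp: V(2) m_def Lsc_indicator_le_iff V(1))
      ultimately have "z \<sqsubseteq>\<^bsub>Lsc X\<^esub> m"
        using * by blast
      then show False
        using p by (auto simp: U(2) m_def Lsc_indicator_le_iff U(1))
    qed
    then show "z \<sqsubseteq>\<^bsub>Lsc X\<^esub> y"
      by (simp add: U(2) V(2) Lsc_indicator_le_iff U(1))
  }
qed

section \<open>Generators of the function monoid and condition (C2)\<close>

text \<open>Upward closed subsets of \<open>{..<m}\<close> are final segments, so their
  cardinalities decide inclusion. At a point, the value of an increasing sum of indicators is such a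
  cardinality.\<close>

lemma card_upward_closed_le_iff:
  fixes m :: nat
  assumes "\<And>i. Suc i < m \<Longrightarrow> a i \<Longrightarrow> a (Suc i)" "\<And>i. Suc i < m \<Longrightarrow> b i \<Longrightarrow> b (Suc i)"
  shows "card {i. i < m \<and> a i} \<le> card {i. i < m \<and> b i} \<longleftrightarrow> (\<forall>i<m. a i \<longrightarrow> b i)"
proof
  assume le: "card {i. i < m \<and> a i} \<le> card {i. i < m \<and> b i}"
  show "\<forall>i<m. a i \<longrightarrow> b i"
  proof (intro allI impI, rule ccontr)
    fix i assume i: "i < m" "a i" "\<not> b i"
    \<comment> \<open>If inclusion fails at \<open>i\<close>, the first set has at least
      \<open>m - i\<close> elements and the second at most \<open>m - Suc i\<close>.\<close>
    have "a j" if "i \<le> j" "j < m" for j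
      using that by (induction j rule: dec_induct) (use i assms(1) in auto)
    then have "{i..<m} \<subseteq> {i. i < m \<and> a i}"
      by auto
    then have 1: "card {i..<m} \<le> card {i. i < m \<and> a i}"
      by (intro card_mono) auto
    have "\<not> b j" if "j \<le> i" for j
    proof
      assume "b j"
      have "k < m \<longrightarrow> b k" if "j \<le> k" for k
        using that by (induction k rule: dec_induct) (use \<open>b j\<close> assms(2) in auto)
      then show False
        using i \<open>j \<le> i\<close> by blast
    qed
    then have "{i. i < m \<and> b i} \<subseteq> {Suc i..<m}"
      by (auto simp: not_le[symmetric] Suc_le_eq)
    then have "card {i. i < m \<and> b i} \<le> card {Suc i..<m}"
      by (intro card_mono) auto
    then show False
      using le 1 i(1) by simp
  qed
qed (auto intro!: card_mono)

lemma osum_Lsc_indicator: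
  assumes "positively_ordered_monoid (Lsc X)" "\<And>i. i < m \<Longrightarrow> openin X (U i)"
  shows "osum (Lsc X) (\<lambda>i. Lsc_indicator X 1 (U i)) m
    = (\<lambda>p\<in>topspace X. enat (card {i. i < m \<and> p \<in> U i}))"
  using assms(2)
proof (induction m)
  case 0
  interpret positively_ordered_monoid "Lsc X"
    by (rule assms)
  show ?case
    by (simp add: Lsc_simps zero_enat_def)
next
  case (Suc m)
  interpret positively_ordered_monoid "Lsc X"
    by (rule assms)
  have *: "{i. i < Suc m \<and> p \<in> U i} =
      (if p \<in> U m then insert m {i. i < m \<and> p \<in> U i} else {i. i < m \<and> p \<in> U i})" for p
    by (auto simp: less_Suc_eq)
  have "osum (Lsc X) (\<lambda>i. Lsc_indicator X 1 (U i)) (Suc m) =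
      osum (Lsc X) (\<lambda>i. Lsc_indicator X 1 (U i)) m \<boxplus>\<^bsub>Lsc X\<^esub> Lsc_indicator X 1 (U m)"
    using Suc.prems by (intro osum_Suc) (simp add: Lsc_indicator_closed)
  also have "\<dots> = (\<lambda>p\<in>topspace X. enat (card {i. i < Suc m \<and> p \<in> U i}))"
    using Suc by (subst Suc.IH) (auto simp: Lsc_simps Lsc_indicator_def * one_enat_def)
  finally show ?case .
qed

text \<open>The constant function 1 serves as the witness \<open>e\<close> in (C2), since functions
  below it take only the values 0 and 1.\<close>

lemma Lsc_down_set_one:
  "down_set (Lsc X) (Lsc_indicator X 1 (topspace X)) = Lsc_indicator X 1 ` {U. openin X U}"
proof (intro equalityI subsetI)
  fix f assume f: "f \<in> down_set (Lsc X) (Lsc_indicator X 1 (topspace X))"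
  then have le: "f p \<le> 1" if "p \<in> topspace X" for p
    using that by (auto simp: down_set_def Lsc_simps Lsc_indicator_def)
  have c: "f \<in> carrier (Lsc X)"
    using f by (simp add: down_set_def)
  have o: "openin X {x \<in> topspace X. enat 1 \<le> f x}"
    by (rule Lsc_openin[OF c])
  have "f = Lsc_indicator X 1 {x \<in> topspace X. enat 1 \<le> f x}"
  proof (rule Lsc_eqI[OF c Lsc_indicator_closed[OF o]])
    fix p assume "p \<in> topspace X"
    then show "f p = Lsc_indicator X 1 {x \<in> topspace X. enat 1 \<le> f x} p"
      using le[of p] by (cases "f p") (auto simp: Lsc_indicator_def one_enat_def zero_enat_def)
  qed
  then show "f \<in> Lsc_indicator X 1 ` {U. openin X U}"
    using o by blast
next
  fix f assume "f \<in> Lsc_indicator X 1 ` {U. openin X U}"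
  then obtain U where "openin X U" "f = Lsc_indicator X 1 U"
    by blast
  then show "f \<in> down_set (Lsc X) (Lsc_indicator X 1 (topspace X))"
    using openin_subset by (auto simp: down_set_def Lsc_indicator_closed Lsc_indicator_le_iff)
qed

text \<open>Along an increasing sequence of open sets the indices \<open>i\<close> with
  \<open>p\<close> in \<open>U i\<close> form a final segment, so at each point the sums compare as
  counts, and counts decide termwise inclusion.\<close>

lemma topological_subset_Lsc:
  assumes "positively_ordered_monoid (Lsc X)"
  shows "topological_subset (Lsc X) (Lsc_indicator X 1 ` {U. openin X U})"
  unfolding topological_subset_def
proof (intro conjI allI impI)
  show "Lsc_indicator X 1 ` {U. openin X U} \<subseteq> carrier (Lsc X)"
    by (auto simp: Lsc_indicator_closed)
  interpret positively_ordered_monoid "Lsc X"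
    by (rule assms)
  have repr: "\<exists>U. (\<forall>i<m. openin X (U i) \<and> x i = Lsc_indicator X 1 (U i)) \<and>
      (\<forall>i. Suc i < m \<longrightarrow> U i \<subseteq> U (Suc i)) \<and>
      osum (Lsc X) x m = (\<lambda>p\<in>topspace X. enat (card {i. i < m \<and> p \<in> U i}))"
    if x: "finite_increasing_in (Lsc X) (Lsc_indicator X 1 ` {U. openin X U}) m x" for m x
  proof -
    have "\<forall>i. \<exists>U. i < m \<longrightarrow> openin X U \<and> x i = Lsc_indicator X 1 U"
      using x by (auto simp: finite_increasing_in_def)
    then obtain U where U: "\<And>i. i < m \<Longrightarrow> openin X (U i) \<and> x i = Lsc_indicator X 1 (U i)"
      by metis
    have "U i \<subseteq> U (Suc i)" if "Suc i < m" for i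
    proof -
      have "x i \<sqsubseteq>\<^bsub>Lsc X\<^esub> x (Suc i)"
        using x that by (simp add: finite_increasing_in_def)
      then show ?thesis
        using that U[of i] U[of "Suc i"] by (simp add: Lsc_indicator_le_iff)
    qed
    moreover have "osum (Lsc X) x m = osum (Lsc X) (\<lambda>i. Lsc_indicator X 1 (U i)) m"
      using U by (intro osum_cong Lsc_indicator_closed) simp_all
    ultimately show ?thesis
      using U osum_Lsc_indicator[OF assms, of m U] by auto
  qed
  fix m x y
  assume *: "finite_increasing_in (Lsc X) (Lsc_indicator X 1 ` {U. openin X U}) m x \<and>
    finite_increasing_in (Lsc X) (Lsc_indicator X 1 ` {U. openin X U}) m y"
  obtain U where U: "\<And>i. i < m \<Longrightarrow> openin X (U i)" "\<And>i. i < m \<Longrightarrow> x i = Lsc_indicator X 1 (U i)"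
      "\<And>i. Suc i < m \<Longrightarrow> U i \<subseteq> U (Suc i)"
      "osum (Lsc X) x m = (\<lambda>p\<in>topspace X. enat (card {i. i < m \<and> p \<in> U i}))"
    using repr[of m x] * by blast
  obtain V where V: "\<And>i. i < m \<Longrightarrow> openin X (V i)" "\<And>i. i < m \<Longrightarrow> y i = Lsc_indicator X 1 (V i)"
      "\<And>i. Suc i < m \<Longrightarrow> V i \<subseteq> V (Suc i)"
      "osum (Lsc X) y m = (\<lambda>p\<in>topspace X. enat (card {i. i < m \<and> p \<in> V i}))"
    using repr[of m y] * by blast
  have "osum (Lsc X) x m \<sqsubseteq>\<^bsub>Lsc X\<^esub> osum (Lsc X) y m \<longleftrightarrow>
      (\<forall>p\<in>topspace X. \<forall>i<m. p \<in> U i \<longrightarrow> p \<in> V i)"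
    using card_upward_closed_le_iff[of m "\<lambda>i. _ \<in> U i" "\<lambda>i. _ \<in> V i"] U(3) V(3)
    by (simp add: U(4) V(4) Lsc_simps subset_iff)
  also have "\<dots> \<longleftrightarrow> (\<forall>i<m. U i \<subseteq> V i)"
    using U(1) openin_subset by blast
  also have "\<dots> \<longleftrightarrow> (\<forall>i<m. x i \<sqsubseteq>\<^bsub>Lsc X\<^esub> y i)"
    using U(1,2) V(2) openin_subset by (simp add: Lsc_indicator_le_iff)
  finally show "osum (Lsc X) x m \<sqsubseteq>\<^bsub>Lsc X\<^esub> osum (Lsc X) y m \<longleftrightarrow> (\<forall>i<m. x i \<sqsubseteq>\<^bsub>Lsc X\<^esub> y i)" .
qed

text \<open>Layer-cake decomposition: the partial sums of the indicators of the sets where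
  \<open>f\<close> is at least \<open>i + 1\<close> are the truncations of \<open>f\<close>.\<close>

lemma sup_dense_Lsc:
  assumes "positively_ordered_monoid (Lsc X)"
  shows "sup_dense (Lsc X) (finite_sums (Lsc X) (Lsc_indicator X 1 ` {U. openin X U}))"
  unfolding sup_dense_def
proof
  interpret positively_ordered_monoid "Lsc X"
    by (rule assms)
  fix f assume f: "f \<in> carrier (Lsc X)"
  define U where "U i = {x \<in> topspace X. enat (Suc i) \<le> f x}" for i
  have U: "openin X (U i)" for i
    unfolding U_def using f by (rule Lsc_openin)
  define z where "z = osum (Lsc X) (\<lambda>i. Lsc_indicator X 1 (U i))"
  have z: "z n p = min (enat n) (f p)" if "p \<in> topspace X" for n p
  proof -
    have "{i. i < n \<and> p \<in> U i} = {i. enat i < min (enat n) (f p)}"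
      using that by (auto simp: U_def Suc_ile_eq)
    also have "\<dots> = {..<the_enat (min (enat n) (f p))}"
      by (cases "f p") (auto simp: min_def)
    finally show ?thesis
      using that U by (cases "f p") (auto simp: z_def osum_Lsc_indicator[OF assms] min_def)
  qed
  have inc: "increasing (Lsc X) z"
    unfolding z_def by (rule increasing_osum) (simp add: Lsc_indicator_closed U)
  moreover have "range z \<subseteq> finite_sums (Lsc X) (Lsc_indicator X 1 ` {U. openin X U})"
    using U by (auto simp: z_def finite_sums_def)
  moreover have "is_seq_sup (Lsc X) f z"
  proof -
    have "f p \<le> t p" if t: "\<And>n. z n p \<le> t p" and p: "p \<in> topspace X" for t :: "'a \<Rightarrow> enat" and p
      \<comment> \<open>The threshold \<open>n + 1\<close> of \<open>f p\<close> is already reached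
        by the truncation at stage \<open>n + 1\<close>.\<close>
      by (rule enat_le_cases) (metis t z[OF p] min.absorb1)
    then show ?thesis
      using f by (subst is_seq_sup_iff) (auto simp: increasing_closed[OF inc] Lsc_simps z)
  qed
  ultimately show "\<exists>z. increasing (Lsc X) z \<and>
      range z \<subseteq> finite_sums (Lsc X) (Lsc_indicator X 1 ` {U. openin X U}) \<and>
      is_seq_sup (Lsc X) f z"
    by (intro exI[of _ z] conjI)
qed

text \<open>The \<open>Cu\<close> property of \<open>Lsc X\<close> is not derived for an arbitrary
  \<open>T1\<close> space; it has to be supplied, and it is part of
  \<open>cu_isomorphic\<close>.\<close>

lemma Lsc_like_Lsc:
  assumes "t1_space X" "cu_semigroup (Lsc X)"
  shows "Lsc_like (Lsc X)"
proof -
  interpret cu_semigroup "Lsc X"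
    by fact
  have "condition_C2 (Lsc X)"
    unfolding condition_C2_def
    using topological_subset_Lsc sup_dense_Lsc positively_ordered_monoid_axioms
      Lsc_indicator_closed[OF openin_topspace] Lsc_down_set_one by metis
  then show ?thesis
    using assms
    by (simp add: Lsc_like_def sup_complete_Lsc distributively_lattice_ordered_Lsc condition_C1_Lsc)
qed

lemma Lsc_like_if_cu_isomorphic:
  assumes "t1_space X" "cu_isomorphic S (Lsc X)"
  shows "Lsc_like S"
proof -
  obtain f g where "ordered_monoid_iso S (Lsc X) f g"
    by (rule cu_isomorphic_imp_iso[OF assms(2)])
  then interpret ordered_monoid_iso "Lsc X" S g f
    by (rule ordered_monoid_iso.iso_sym)
  have cu: "cu_semigroup S" "cu_semigroup (Lsc X)"
    using assms(2) by (simp_all add: cu_isomorphic_def)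
  then have "Lsc_like (Lsc X)"
    using Lsc_like_Lsc assms(1) by blast
  then show ?thesis
    using cu sup_complete_iso distributively_lattice_ordered_iso condition_C1_iso condition_C2_iso
    by (auto simp: Lsc_like_def cu_semigroup_def)
qed

section \<open>Decreasing sequences of generators\<close>

text \<open>One witness \<open>e\<close> of (C2) is fixed for the whole construction; it corresponds
  to the constant function 1, and its down-set to the indicators of open sets.\<close>

locale lsc_like = cu_semigroup +
  fixes e
  assumes sup_complete: "sup_complete S"
    and distributive: "distributively_lattice_ordered S"
    and C1: "condition_C1 S"
    and e_closed [simp, intro]: "e \<in> carrier S"
    and topological: "topological_subset S (down_set S e)"
    and dense: "sup_dense S (finite_sums S (down_set S e))"
begin

abbreviation H where "H \<equiv> down_set S e"

lemma H_iff: "h \<in> H \<longleftrightarrow> h \<in> carrier S \<and> h \<sqsubseteq> e"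
  by (simp add: down_set_def)

lemma H_closed: "h \<in> H \<Longrightarrow> h \<in> carrier S"
  by (simp add: H_iff)

lemma H_downward: "\<lbrakk>h \<in> H; k \<in> carrier S; k \<sqsubseteq> h\<rbrakk> \<Longrightarrow> k \<in> H"
  using le_trans[of k h e] by (simp add: H_iff)

lemma ozero_H [simp]: "ozero S \<in> H"
  by (simp add: H_iff zero_le)

lemma lattice: "lattice S"
  using distributive by (simp add: distributively_lattice_ordered_def)

lemma
  assumes "x \<in> carrier S" "y \<in> carrier S"
  shows meet_closed [simp]: "x \<sqinter> y \<in> carrier S"
    and join_closed [simp]: "x \<squnion> y \<in> carrier S"
    and meet_lower: "x \<sqinter> y \<sqsubseteq> x" "x \<sqinter> y \<sqsubseteq> y"
    and join_upper: "x \<sqsubseteq> x \<squnion> y" "y \<sqsubseteq> x \<squnion> y"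
proof -
  interpret l: lattice S
    by (rule lattice)
  show "x \<sqinter> y \<in> carrier S" "x \<squnion> y \<in> carrier S" "x \<sqinter> y \<sqsubseteq> x" "x \<sqinter> y \<sqsubseteq> y"
    "x \<sqsubseteq> x \<squnion> y" "y \<sqsubseteq> x \<squnion> y"
    using l.meet_closed[OF assms] l.join_closed[OF assms] l.meet_left[OF assms]
      l.meet_right[OF assms] l.join_left[OF assms] l.join_right[OF assms]
    by this+
qed

lemmas le_meet_iff = lattice.le_meet_iff[OF lattice]
  and join_le_iff = lattice.join_le_iff[OF lattice]

lemma meet_join_distrib:
  "\<lbrakk>x \<in> carrier S; y \<in> carrier S; z \<in> carrier S\<rbrakk> \<Longrightarrow> x \<sqinter> (y \<squnion> z) = (x \<sqinter> y) \<squnion> (x \<sqinter> z)"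
  using distributive unfolding distributively_lattice_ordered_def by blast

lemma add_eq_join_add_meet:
  "\<lbrakk>x \<in> carrier S; y \<in> carrier S\<rbrakk> \<Longrightarrow> x \<boxplus> y = (x \<squnion> y) \<boxplus> (x \<sqinter> y)"
  using distributive unfolding distributively_lattice_ordered_def by blast

text \<open>Abstract layer cake: \<open>x i\<close> stands for the indicator of the superlevel set
  at height \<open>i + 1\<close>, which is why the sequence decreases.\<close>

definition chain :: "(nat \<Rightarrow> 'a) \<Rightarrow> bool" where
  "chain x \<longleftrightarrow> (\<forall>i. x i \<in> H \<and> x (Suc i) \<sqsubseteq> x i)"

definition rep :: "'a \<Rightarrow> (nat \<Rightarrow> 'a) \<Rightarrow> bool" where
  "rep s x \<longleftrightarrow> chain x \<and> is_seq_sup S s (osum S x)"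

lemma chain_H: "chain x \<Longrightarrow> x i \<in> H"
  by (simp add: chain_def)

lemma chain_closed: "chain x \<Longrightarrow> x i \<in> carrier S"
  by (simp add: chain_def H_iff)

lemma chain_mono:
  assumes "chain x" "i \<le> j"
  shows "x j \<sqsubseteq> x i"
  using assms(2)
proof (induction j rule: dec_induct)
  case base
  then show ?case
    using chain_closed[OF assms(1)] by simp
next
  case (step j)
  have "x (Suc j) \<sqsubseteq> x j"
    using assms(1) by (simp add: chain_def)
  from le_trans[OF this step.IH] show ?case
    using chain_closed[OF assms(1)] by simp
qed

lemma osum_chain_closed [simp]: "chain x \<Longrightarrow> osum S x n \<in> carrier S"
  by (rule osum_closed) (rule chain_closed)

text \<open>Reversal turns both chains into increasing sequences of the same length, to which the
  topological condition applies.\<close>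

lemma osum_chain_le_iff:
  assumes "chain x" "chain y"
  shows "osum S x m \<sqsubseteq> osum S y m \<longleftrightarrow> (\<forall>i<m. x i \<sqsubseteq> y i)"
proof -
  have fin: "finite_increasing_in S H m (\<lambda>i. w (m - Suc i))" if "chain w" for w
    using chain_H[OF that] chain_mono[OF that] by (simp add: finite_increasing_in_def)
  have rev: "osum S (\<lambda>i. w (m - Suc i)) m = osum S w m" if "chain w" for w
    using chain_closed[OF that] by (intro osum_reverse)
  have "osum S x m \<sqsubseteq> osum S y m \<longleftrightarrow> (\<forall>i<m. x (m - Suc i) \<sqsubseteq> y (m - Suc i))"
    using topological fin[OF assms(1)] fin[OF assms(2)]
    unfolding topological_subset_def rev[OF assms(1), symmetric] rev[OF assms(2), symmetric]
    by blast
  also have "\<dots> \<longleftrightarrow> (\<forall>i<m. x i \<sqsubseteq> y i)"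
  proof safe
    fix i assume *: "\<forall>i<m. x (m - Suc i) \<sqsubseteq> y (m - Suc i)" "i < m"
    then have "m - Suc i < m" "m - Suc (m - Suc i) = i"
      by auto
    then show "x i \<sqsubseteq> y i"
      using * by metis
  qed simp
  finally show ?thesis .
qed

lemma rep_sup:
  assumes "rep s x"
  shows "s \<in> carrier S" "osum S x n \<sqsubseteq> s"
    "\<lbrakk>t \<in> carrier S; \<And>n. osum S x n \<sqsubseteq> t\<rbrakk> \<Longrightarrow> s \<sqsubseteq> t"
  using assms is_seq_sup_iff[of "osum S x" S s] by (auto simp: rep_def)

lemma rep_chain: "rep s x \<Longrightarrow> chain x"
  by (simp add: rep_def)

lemma repI:
  assumes "chain x" "s \<in> carrier S" "\<And>n. osum S x n \<sqsubseteq> s"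
    "\<And>t. \<lbrakk>t \<in> carrier S; \<And>n. osum S x n \<sqsubseteq> t\<rbrakk> \<Longrightarrow> s \<sqsubseteq> t"
  shows "rep s x"
  using assms is_seq_sup_iff[of "osum S x" S s] by (auto simp: rep_def)

text \<open>The left side does not mention \<open>x\<close>, so the coefficients can be recovered
  from \<open>s\<close>. For a long partial sum in place of \<open>s\<close> this is the termwise
  comparison of chains; since \<open>s\<close> is only a supremum, \<open>h\<close> is first
  replaced by terms \<open>z n\<close> way below it, whose multiples fall below a partial
  sum.\<close>

lemma multiple_le_iff:
  assumes s: "rep s x" and h: "h \<in> H"
  shows "osum S (\<lambda>_. h) (Suc k) \<sqsubseteq> s \<longleftrightarrow> h \<sqsubseteq> x k"
proof
  note x = rep_chain[OF s] and hc = H_closed[OF h]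
  assume "h \<sqsubseteq> x k"
  then have "h \<sqsubseteq> x i" if "i < Suc k" for i
    using le_trans[OF _ chain_mono[OF x, of i k]] that hc chain_closed[OF x] by simp
  then have "osum S (\<lambda>_. h) (Suc k) \<sqsubseteq> osum S x (Suc k)"
    using hc chain_closed[OF x] by (intro osum_mono)
  from le_trans[OF this rep_sup(2)[OF s]] show "osum S (\<lambda>_. h) (Suc k) \<sqsubseteq> s"
    using hc x rep_sup(1)[OF s] by simp
next
  note x = rep_chain[OF s] and hc = H_closed[OF h]
  assume le: "osum S (\<lambda>_. h) (Suc k) \<sqsubseteq> s"
  obtain z where z: "increasing S z" "is_seq_sup S h z" "\<And>n. way_below S (z n) h"
    by (rule way_below_approx[OF hc]) (rule that)
  note zc = increasing_closed[OF z(1)]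
  have "z n \<sqsubseteq> x k" for n
  proof -
    have zH: "z n \<in> H"
      using H_downward[OF h zc] z(2) is_seq_sup_iff[of z] zc by blast
    have "way_below S (osum S (\<lambda>_. z n) (Suc k)) (osum S (\<lambda>_. h) (Suc k))"
      by (rule way_below_osum_const[OF z(3)])
    then obtain m where m: "osum S (\<lambda>_. z n) (Suc k) \<sqsubseteq> osum S x m"
      using le s increasing_osum[of x] chain_closed[OF x] unfolding way_below_def rep_def by blast
    \<comment> \<open>Termwise comparison needs equal lengths: \<open>y\<close> is
      \<open>z n\<close> repeated \<open>k + 1\<close> times and then zero, which still decreases,
      and \<open>M\<close> is long enough for both sums.\<close>
    define M where "M = max m (Suc k)"
    define y where "y i = (if i < Suc k then z n else ozero S)" for i
    have y: "chain y"
      using zH zc zero_le by (auto simp: chain_def y_def)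
    have "osum S y M = osum S y (Suc k)"
      using chain_closed[OF y] by (intro osum_pad) (auto simp: M_def y_def)
    also have "\<dots> = osum S (\<lambda>_. z n) (Suc k)"
      by (rule osum_cong) (auto simp: y_def zc)
    finally have "osum S y M \<sqsubseteq> osum S x m"
      using m by simp
    moreover have "osum S x m \<sqsubseteq> osum S x M"
      using chain_closed[OF x] by (intro osum_le_osum) (simp_all add: M_def)
    ultimately have "osum S y M \<sqsubseteq> osum S x M"
      by (rule le_trans) (simp_all add: x y)
    then have "y k \<sqsubseteq> x k"
      by (simp add: osum_chain_le_iff x y M_def)
    then show ?thesis
      by (simp add: y_def)
  qed
  then show "h \<sqsubseteq> x k"
    using z(2) is_seq_sup_iff[of z] zc chain_closed[OF x] by blast
qed

text \<open>In the forward direction \<open>x i\<close> itself is the test element: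
  \<open>i + 1\<close> copies of it lie below \<open>s\<close>, hence below
  \<open>t\<close>.\<close>

lemma rep_le_iff:
  assumes s: "rep s x" and t: "rep t y"
  shows "s \<sqsubseteq> t \<longleftrightarrow> (\<forall>i. x i \<sqsubseteq> y i)"
proof
  note x = rep_chain[OF s] and y = rep_chain[OF t]
  assume le: "s \<sqsubseteq> t"
  show "\<forall>i. x i \<sqsubseteq> y i"
  proof
    fix i
    have "osum S (\<lambda>_. x i) (Suc i) \<sqsubseteq> s"
      using multiple_le_iff[OF s chain_H[OF x]] chain_closed[OF x] by simp
    from le_trans[OF this le] have "osum S (\<lambda>_. x i) (Suc i) \<sqsubseteq> t"
      using rep_sup(1)[OF s] rep_sup(1)[OF t] chain_closed[OF x] by simp
    then show "x i \<sqsubseteq> y i"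
      using multiple_le_iff[OF t chain_H[OF x]] by simp
  qed
next
  note x = rep_chain[OF s] and y = rep_chain[OF t]
  assume le: "\<forall>i. x i \<sqsubseteq> y i"
  show "s \<sqsubseteq> t"
  proof (rule rep_sup(3)[OF s rep_sup(1)[OF t]])
    fix n
    have "osum S x n \<sqsubseteq> osum S y n"
      using le chain_closed[OF x] chain_closed[OF y] by (intro osum_mono) simp_all
    from le_trans[OF this rep_sup(2)[OF t]] show "osum S x n \<sqsubseteq> t"
      using x y rep_sup(1)[OF t] by simp
  qed
qed

lemma rep_unique:
  assumes "rep s x" "rep s y"
  shows "x = y"
proof
  fix i
  have "s \<sqsubseteq> s"
    using rep_sup(1)[OF assms(1)] by simp
  then show "x i = y i"
    using rep_le_iff[OF assms] rep_le_iff[OF assms(2,1)] chain_closed[OF rep_chain] assms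
    by (intro le_antisym) simp_all
qed

lemma rep_finite:
  assumes "chain x" "\<And>i. m \<le> i \<Longrightarrow> x i = ozero S"
  shows "rep (osum S x m) x"
proof (rule repI[OF assms(1)])
  show "osum S x m \<in> carrier S"
    using assms(1) by simp
  show "osum S x n \<sqsubseteq> osum S x m" for n
  proof (cases "n \<le> m")
    case True
    then show ?thesis
      using chain_closed[OF assms(1)] by (intro osum_le_osum)
  next
    case False
    then have "osum S x n = osum S x m"
      using chain_closed[OF assms(1)] assms(2) by (intro osum_pad) auto
    then show ?thesis
      using assms(1) by simp
  qed
qed

text \<open>Adding a generator to a decreasing sum: \<open>x + y = (x \<or> y) + (x \<and> y)\<close> exchanges the
  remainder \<open>insert_rest h x i\<close> with the \<open>i\<close>-th summand, as in insertion sort.\<close>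

definition insert_rest :: "'a \<Rightarrow> (nat \<Rightarrow> 'a) \<Rightarrow> nat \<Rightarrow> 'a" where
  "insert_rest h x i = (case i of 0 \<Rightarrow> h | Suc j \<Rightarrow> h \<sqinter> x j)"

definition insert_chain :: "'a \<Rightarrow> (nat \<Rightarrow> 'a) \<Rightarrow> nat \<Rightarrow> 'a" where
  "insert_chain h x i = insert_rest h x i \<squnion> x i"

lemma insert_rest_closed: "\<lbrakk>h \<in> H; chain x\<rbrakk> \<Longrightarrow> insert_rest h x i \<in> carrier S"
  using chain_closed H_closed by (simp add: insert_rest_def split: nat.split)

lemma insert_rest_le: "\<lbrakk>h \<in> H; chain x\<rbrakk> \<Longrightarrow> insert_rest h x i \<sqsubseteq> h"
  using chain_closed H_closed by (simp add: insert_rest_def meet_lower split: nat.split)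

text \<open>After \<open>i + 1\<close> exchanges the remainder is the meet of \<open>h\<close> with
  \<open>x 0\<close>, ..., \<open>x i\<close>; as \<open>x\<close> decreases, this collapses to the
  meet of \<open>h\<close> and \<open>x i\<close>.\<close>

lemma insert_rest_meet:
  assumes h: "h \<in> H" and x: "chain x"
  shows "insert_rest h x i \<sqinter> x i = insert_rest h x (Suc i)"
proof (cases i)
  case (Suc j)
  note c = H_closed[OF h] chain_closed[OF x]
  have le: "x (Suc j) \<sqsubseteq> x j"
    using x by (simp add: chain_def)
  have 1: "h \<sqinter> x j \<sqsubseteq> h" "h \<sqinter> x (Suc j) \<sqsubseteq> h" "h \<sqinter> x (Suc j) \<sqsubseteq> x (Suc j)"
    "h \<sqinter> x j \<sqinter> x (Suc j) \<sqsubseteq> h \<sqinter> x j" "h \<sqinter> x j \<sqinter> x (Suc j) \<sqsubseteq> x (Suc j)"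
    using c by (simp_all add: meet_lower)
  have "h \<sqinter> x j \<sqinter> x (Suc j) \<sqsubseteq> h"
    by (rule le_trans[OF 1(4,1)]) (simp_all add: c)
  moreover have "h \<sqinter> x (Suc j) \<sqsubseteq> x j"
    by (rule le_trans[OF 1(3) le]) (simp_all add: c)
  ultimately have "h \<sqinter> x j \<sqinter> x (Suc j) = h \<sqinter> x (Suc j)"
    using 1 c by (intro le_antisym) (simp_all add: le_meet_iff)
  then show ?thesis
    by (simp add: insert_rest_def Suc)
qed (simp add: insert_rest_def)

text \<open>Both parts of the join at \<open>Suc i\<close> lie below \<open>x i\<close>, which is a
  part of the join at \<open>i\<close>.\<close>

lemma chain_insert:
  assumes h: "h \<in> H" and x: "chain x"
  shows "chain (insert_chain h x)"
  unfolding chain_def insert_chain_def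
proof (intro allI conjI)
  fix i
  note c = H_closed[OF h] chain_closed[OF x] insert_rest_closed[OF h x]
  have "insert_rest h x i \<sqsubseteq> e"
    by (rule le_trans[OF insert_rest_le[OF h x]]) (use h in \<open>simp_all add: H_iff c\<close>)
  then show "insert_rest h x i \<squnion> x i \<in> H"
    using chain_H[OF x, of i] by (simp add: H_iff join_le_iff c)
  have "insert_rest h x (Suc i) \<sqsubseteq> x i"
    using c by (simp add: insert_rest_def meet_lower)
  then have "insert_rest h x (Suc i) \<squnion> x (Suc i) \<sqsubseteq> x i"
    using x by (simp add: join_le_iff c chain_def)
  then show "insert_rest h x (Suc i) \<squnion> x (Suc i) \<sqsubseteq> insert_rest h x i \<squnion> x i"
    by (rule le_trans) (simp_all add: c join_upper)
qed

text \<open>Invariant of the insertion: after \<open>m\<close> exchanges the first \<open>m\<close>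
  summands are final and one remainder is left over.\<close>

lemma add_osum_chain:
  assumes h: "h \<in> H" and x: "chain x"
  shows "h \<boxplus> osum S x m = osum S (insert_chain h x) m \<boxplus> insert_rest h x m"
proof (induction m)
  case 0
  then show ?case
    using H_closed[OF h] by (simp add: insert_rest_def)
next
  case (Suc m)
  note c = H_closed[OF h] chain_closed[OF x] insert_rest_closed[OF h x]
    chain_closed[OF chain_insert[OF h x]] osum_chain_closed[OF chain_insert[OF h x]]
    osum_chain_closed[OF x]
  have "h \<boxplus> osum S x (Suc m) = h \<boxplus> osum S x m \<boxplus> x m"
    using c by (simp add: osum_Suc oplus_assoc)
  also have "\<dots> = osum S (insert_chain h x) m \<boxplus> (insert_rest h x m \<boxplus> x m)"
    using c by (simp add: Suc oplus_assoc)
  also have "insert_rest h x m \<boxplus> x m = insert_chain h x m \<boxplus> insert_rest h x (Suc m)"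
    using add_eq_join_add_meet[of "insert_rest h x m" "x m"] c
    by (simp add: insert_rest_meet[OF h x] insert_chain_def)
  finally show ?case
    using c by (simp add: osum_Suc oplus_assoc)
qed

lemma insert_rest_finite:
  assumes "h \<in> H" "chain x" "\<And>i. m \<le> i \<Longrightarrow> x i = ozero S" "m < i"
  shows "insert_rest h x i = ozero S"
proof -
  obtain j where j: "i = Suc j" "m \<le> j"
    using assms(4) by (cases i) auto
  have "h \<sqinter> ozero S = ozero S"
    using H_closed[OF assms(1)] by (intro le_antisym) (simp_all add: meet_lower zero_le)
  then show ?thesis
    using j assms(3) by (simp add: insert_rest_def)
qed

lemma join_ozero: "x \<in> carrier S \<Longrightarrow> x \<squnion> ozero S = x"
  by (intro le_antisym) (simp_all add: join_le_iff zero_le join_upper)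

text \<open>The chain is zero at position \<open>m\<close>, so the remainder itself is stored there:
  the sum grows by one term and nothing is left over.\<close>

lemma add_finite_chain:
  assumes h: "h \<in> H" and x: "chain x" and z: "\<And>i. m \<le> i \<Longrightarrow> x i = ozero S"
  shows "h \<boxplus> osum S x m = osum S (insert_chain h x) (Suc m)"
    and "Suc m \<le> i \<Longrightarrow> insert_chain h x i = ozero S"
proof -
  note c = chain_closed[OF chain_insert[OF h x]]
  have "insert_chain h x m = insert_rest h x m"
    using insert_rest_closed[OF h x] by (simp add: insert_chain_def z join_ozero)
  then show "h \<boxplus> osum S x m = osum S (insert_chain h x) (Suc m)"
    using c by (simp add: add_osum_chain[OF h x] osum_Suc)
  show "insert_chain h x i = ozero S" if "Suc m \<le> i"
  proof -
    have "insert_rest h x i = ozero S"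
      using that by (intro insert_rest_finite[OF h x z]) (simp_all add: Suc_le_eq)
    then show ?thesis
      using z[of i] that by (simp add: insert_chain_def join_ozero)
  qed
qed

section \<open>Existence of coefficient sequences\<close>

lemma finite_sums_closed: "s \<in> finite_sums S H \<Longrightarrow> s \<in> carrier S"
  unfolding finite_sums_def using H_closed by (auto intro!: osum_closed)

text \<open>Reduces statements on arbitrary finite sums to the insertion of one generator.\<close>

lemma finite_sums_induct [consumes 1, case_names zero add]:
  assumes "s \<in> finite_sums S H"
    and zero: "P (ozero S)"
    and add: "\<And>h s. \<lbrakk>h \<in> H; s \<in> finite_sums S H; P s\<rbrakk> \<Longrightarrow> P (h \<boxplus> s)"
  shows "P s"
proof -
  obtain x m where s: "s = osum S x m" and x: "\<forall>i<m. x i \<in> H"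
    using assms(1) by (auto simp: finite_sums_def)
  show ?thesis
    unfolding s using x
  proof (induction m)
    case 0
    then show ?case
      using zero by simp
  next
    case (Suc m)
    have "osum S x (Suc m) = osum S x m \<boxplus> x m"
      using Suc.prems H_closed by (intro osum_Suc) simp
    also have "\<dots> = x m \<boxplus> osum S x m"
      using Suc.prems H_closed by (intro oplus_comm osum_closed) simp_all
    finally have "osum S x (Suc m) = x m \<boxplus> osum S x m" .
    moreover have "osum S x m \<in> finite_sums S H"
      unfolding finite_sums_def using Suc.prems
      by (intro CollectI exI[of _ x] exI[of _ m]) simp
    ultimately show ?case
      using Suc add[of "x m" "osum S x m"] by simp
  qed
qed

lemma finite_sums_chain:
  assumes "s \<in> finite_sums S H"
  obtains x m where "chain x" "\<And>i. m \<le> i \<Longrightarrow> x i = ozero S" "s = osum S x m"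
proof -
  have "\<exists>x m. chain x \<and> (\<forall>i. m \<le> i \<longrightarrow> x i = ozero S) \<and> s = osum S x m"
    using assms
  proof (induction rule: finite_sums_induct)
    case zero
    have "chain (\<lambda>_. ozero S) \<and> (\<forall>i. 0 \<le> i \<longrightarrow> ozero S = ozero S) \<and>
        ozero S = osum S (\<lambda>_. ozero S) 0"
      by (simp add: chain_def)
    then show ?case
      by blast
  next
    case (add h s)
    then obtain x m where x: "chain x" "\<And>i. m \<le> i \<Longrightarrow> x i = ozero S" "s = osum S x m"
      by blast
    have "chain (insert_chain h x) \<and> (\<forall>i. Suc m \<le> i \<longrightarrow> insert_chain h x i = ozero S) \<and>
        h \<boxplus> s = osum S (insert_chain h x) (Suc m)"
      using chain_insert add_finite_chain add(1) x by blast
    then show ?case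
      by blast
  qed
  then show ?thesis
    using that by blast
qed

lemma finite_sums_sup:
  assumes "s \<in> carrier S"
  obtains z where "increasing S z" "\<And>n. z n \<in> finite_sums S H" "is_seq_sup S s z"
proof -
  obtain z where "increasing S z" "range z \<subseteq> finite_sums S H" "is_seq_sup S s z"
    using dense assms unfolding sup_dense_def by blast
  then show ?thesis
    using that by blast
qed

text \<open>The coefficients of \<open>s\<close> are the suprema of those of approximating finite
  sums. They increase with \<open>n\<close> because represented elements are ordered componentwise;
  (O1) gives the suprema and (O4) makes them compatible with partial sums.\<close>

lemma rep_exists:
  assumes "s \<in> carrier S"
  shows "\<exists>x. rep s x"
proof -
  obtain z where z: "increasing S z" "\<And>n. z n \<in> finite_sums S H" "is_seq_sup S s z"
    by (rule finite_sums_sup[OF assms]) (rule that)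
  have zc: "z n \<in> carrier S" for n
    by (rule increasing_closed[OF z(1)])
  have "\<exists>x m. chain x \<and> (\<forall>i. m \<le> i \<longrightarrow> x i = ozero S) \<and> z n = osum S x m" for n
    using finite_sums_chain[OF z(2)] by metis
  then obtain X m where X: "\<And>n. chain (X n)" "\<And>n i. m n \<le> i \<Longrightarrow> X n i = ozero S"
      "\<And>n. z n = osum S (X n) (m n)"
    by metis
  have rep: "rep (z n) (X n)" for n
    unfolding X(3)[of n] by (rule rep_finite[OF X(1,2)])
  have Xc: "X n i \<in> carrier S" for n i
    by (rule chain_closed[OF X(1)])
  have X_le: "X n i \<sqsubseteq> X (Suc n) i" for n i
    using rep_le_iff[OF rep rep, of n "Suc n"] z(1) by (simp add: increasing_def)
  then have "increasing S (\<lambda>n. X n i)" for i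
    using Xc by (auto intro!: increasingI)
  then have "\<forall>i. \<exists>x. is_seq_sup S x (\<lambda>n. X n i)"
    using O1 by blast
  then obtain x where x: "\<And>i. is_seq_sup S (x i) (\<lambda>n. X n i)"
    by metis
  have xc: "x i \<in> carrier S" and X_x: "X n i \<sqsubseteq> x i"
    and x_least: "t \<in> carrier S \<Longrightarrow> (\<And>n. X n i \<sqsubseteq> t) \<Longrightarrow> x i \<sqsubseteq> t" for i n t
    using x[of i] is_seq_sup_iff[of "\<lambda>n. X n i" S "x i"] Xc by auto
  have chain: "chain x"
    unfolding chain_def
  proof (intro allI conjI)
    fix i
    have "X n i \<sqsubseteq> e" for n
      using chain_H[OF X(1)] by (simp add: H_iff)
    then show "x i \<in> H"
      using x_least xc by (simp add: H_iff)
    have "X n (Suc i) \<sqsubseteq> x i" for n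
      by (rule le_trans[OF chain_mono[OF X(1), of i "Suc i"] X_x]) (simp_all add: Xc xc)
    then show "x (Suc i) \<sqsubseteq> x i"
      using x_least xc by simp
  qed
  \<comment> \<open>The supremum over \<open>n\<close> commutes with a partial sum of fixed length
    \<open>k\<close>, by (O4) once per summand.\<close>
  have sup: "is_seq_sup S (osum S x k) (\<lambda>n. osum S (X n) k)" for k
  proof (induction k)
    case 0
    show ?case
      using is_seq_sup_iff[of "\<lambda>n. ozero S" S "ozero S"] by simp
  next
    case (Suc k)
    have "osum S (X n) k \<sqsubseteq> osum S (X (Suc n)) k" for n
      using X_le Xc by (intro osum_mono)
    then have "increasing S (\<lambda>n. osum S (X n) k)"
      using X(1) by (intro increasingI) simp_all
    moreover have "increasing S (\<lambda>n. X n k)"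
      using X_le Xc by (intro increasingI)
    ultimately have "is_seq_sup S (osum S x k \<boxplus> x k) (\<lambda>n. osum S (X n) k \<boxplus> X n k)"
      using Suc x by (intro O4)
    then show ?case
      using xc Xc by (simp add: osum_Suc)
  qed
  have s: "z n \<sqsubseteq> s" "t \<in> carrier S \<Longrightarrow> (\<And>n. z n \<sqsubseteq> t) \<Longrightarrow> s \<sqsubseteq> t" for n t
    using z(3) is_seq_sup_iff[of z S s] zc by auto
  have "rep s x"
  proof (rule repI[OF chain assms])
    fix k
    have "osum S (X n) k \<sqsubseteq> s" for n
      by (rule le_trans[OF rep_sup(2)[OF rep] s(1)]) (simp_all add: X(1) zc assms)
    then show "osum S x k \<sqsubseteq> s"
      using sup[of k] is_seq_sup_iff[of "\<lambda>n. osum S (X n) k"] X(1) assms by simp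
  next
    fix t assume t: "t \<in> carrier S" "\<And>k. osum S x k \<sqsubseteq> t"
    have "z n \<sqsubseteq> t" for n
    proof -
      \<comment> \<open>The number \<open>m n\<close> of summands of \<open>z n\<close> varies with
        \<open>n\<close>, so \<open>z n\<close> is compared with the partial sum of \<open>x\<close>
        of that same length.\<close>
      have "osum S (X n) (m n) \<sqsubseteq> osum S x (m n)"
        using Xc xc X_x by (intro osum_mono)
      from le_trans[OF this t(2)] show ?thesis
        using t(1) chain X(1) by (simp add: X(3))
    qed
    then show "s \<sqsubseteq> t"
      using s(2) t(1) by blast
  qed
  then show ?thesis
    by blast
qed

text \<open>The choice is harmless: \<open>rep_exists\<close> provides such a sequence and
  \<open>rep_unique\<close> leaves only one.\<close>

definition coeff :: "'a \<Rightarrow> nat \<Rightarrow> 'a" where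
  "coeff s = (SOME x. rep s x)"

lemma rep_coeff: "s \<in> carrier S \<Longrightarrow> rep s (coeff s)"
  unfolding coeff_def by (rule someI_ex[OF rep_exists])

lemma coeff_eqI: "rep s x \<Longrightarrow> coeff s = x"
  using rep_unique rep_coeff rep_sup(1) by blast

lemma chain_has_rep:
  assumes "chain x"
  shows "\<exists>s. rep s x"
proof -
  have "increasing S (osum S x)"
    using chain_closed[OF assms] by (intro increasing_osum)
  then show ?thesis
    using O1 assms by (auto simp: rep_def)
qed

lemma le_iff_coeff_le:
  "\<lbrakk>s \<in> carrier S; t \<in> carrier S\<rbrakk> \<Longrightarrow> s \<sqsubseteq> t \<longleftrightarrow> (\<forall>i. coeff s i \<sqsubseteq> coeff t i)"
  by (intro rep_le_iff rep_coeff)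

end

section \<open>The space of maximal idempotents\<close>

text \<open>If \<open>A\<close> reaches \<open>k\<close>, split as \<open>k + 0\<close>; otherwise
  \<open>A\<close> is finite, contributes its full value, and \<open>B\<close> covers the
  rest.\<close>

lemma enat_le_addE:
  assumes "enat k \<le> A + B"
  obtains i j where "k = i + j" "enat i \<le> A" "enat j \<le> B"
proof (cases "enat k \<le> A")
  case True
  then show ?thesis
    using that[of k 0] by (simp add: zero_enat_def[symmetric])
next
  case False
  then obtain a where a: "A = enat a" "a < k"
    by (cases A) auto
  then show ?thesis
    using that[of a "k - a"] assms by (cases B) auto
qed

text \<open>The counterpart of (O4) for values: a finite threshold splits into two, each reached at
  some index, and by monotonicity the larger index serves both.\<close>

lemma enat_SUP_add:
  fixes a b :: "nat \<Rightarrow> enat"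
  assumes "mono a" "mono b"
  shows "(SUP n. a n + b n) = (SUP n. a n) + (SUP n. b n)"
proof (rule antisym)
  show "(SUP n. a n + b n) \<le> (SUP n. a n) + (SUP n. b n)"
    by (intro SUP_least add_mono SUP_upper) simp_all
  have *: "\<exists>n. enat i \<le> c n" if "enat i \<le> (SUP n. c n)" for i and c :: "nat \<Rightarrow> enat"
  proof (cases i)
    case (Suc k)
    then show ?thesis
      using that by (simp add: enat_Suc_le_SUP_iff)
  qed (simp add: zero_enat_def[symmetric])
  show "(SUP n. a n) + (SUP n. b n) \<le> (SUP n. a n + b n)"
  proof (rule enat_le_cases)
    fix k assume "enat (Suc k) \<le> (SUP n. a n) + (SUP n. b n)"
    then obtain i j where ij: "Suc k = i + j" "enat i \<le> (SUP n. a n)" "enat j \<le> (SUP n. b n)"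
      by (rule enat_le_addE)
    obtain m n where "enat i \<le> a m" "enat j \<le> b n"
      using *[OF ij(2)] *[OF ij(3)] by blast
    then have "enat i \<le> a (max m n)" "enat j \<le> b (max m n)"
      using assms by (meson max.cobounded1 max.cobounded2 monoD order_trans)+
    then have "enat i + enat j \<le> a (max m n) + b (max m n)"
      by (rule add_mono)
    also have "\<dots> \<le> (SUP n. a n + b n)"
      by (rule SUP_upper) simp
    finally show "enat (Suc k) \<le> (SUP n. a n + b n)"
      using ij(1) by simp
  qed
qed

lemma enat_eqI: "(\<And>n. enat (Suc n) \<le> a \<longleftrightarrow> enat (Suc n) \<le> b) \<Longrightarrow> a = (b :: enat)"
  by (rule antisym; rule enat_le_cases) simp_all

lemma enat_Suc_le_one_add: "enat (Suc i) \<le> 1 + a \<longleftrightarrow> enat i \<le> a"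
  by (cases a) (simp_all add: one_enat_def)

context lsc_like
begin

section \<open>Idempotents as infinite multiples of generators\<close>

lemma idempotents_closed: "y \<in> idempotents S \<Longrightarrow> y \<in> carrier S"
  by (simp add: idempotents_def)

lemma osum_idempotent:
  assumes "y \<in> idempotents S"
  shows "osum S (\<lambda>_. y) (Suc n) = y"
proof (induction n)
  case 0
  show ?case
    using idempotents_closed[OF assms] osum_Suc[of 0 "\<lambda>_. y"] by simp
next
  case (Suc n)
  then show ?case
    using assms osum_Suc[of "Suc n" "\<lambda>_. y"] by (simp add: idempotents_def)
qed

text \<open>Positive multiples of an idempotent equal it, so by \<open>multiple_le_iff\<close> every
  coefficient of \<open>y\<close> is the largest element of \<open>H\<close> below
  \<open>y\<close>.\<close>

lemma rep_idempotent:
  assumes y: "y \<in> idempotents S"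
  shows "rep y (\<lambda>_. y \<sqinter> e)"
proof -
  note yc = idempotents_closed[OF y]
  obtain x where x: "rep y x"
    using rep_exists[OF yc] by blast
  note xc = chain_closed[OF rep_chain[OF x]] and xH = chain_H[OF rep_chain[OF x]]
  have H: "y \<sqinter> e \<in> H"
    using yc by (simp add: H_iff meet_lower)
  have "x k = y \<sqinter> e" for k
  proof (rule le_antisym)
    have "osum S (\<lambda>_. y \<sqinter> e) (Suc k) \<sqsubseteq> osum S (\<lambda>_. y) (Suc k)"
      using yc by (intro osum_mono) (simp_all add: meet_lower)
    then show "y \<sqinter> e \<sqsubseteq> x k"
      by (simp only: osum_idempotent[OF y] multiple_le_iff[OF x H])
    have "x k \<sqsubseteq> osum S (\<lambda>_. x k) (Suc k)"
      using osum_le_osum[of "\<lambda>_. x k" 1 "Suc k"] osum_Suc[of 0 "\<lambda>_. x k"] xc by simp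
    moreover have "osum S (\<lambda>_. x k) (Suc k) \<sqsubseteq> y"
      using multiple_le_iff[OF x xH] xc by simp
    ultimately have "x k \<sqsubseteq> y"
      by (rule le_trans) (use xc yc in auto)
    then show "x k \<sqsubseteq> y \<sqinter> e"
      using xH yc by (simp add: le_meet_iff H_iff)
  qed (use xc yc in auto)
  then have "x = (\<lambda>_. y \<sqinter> e)"
    by (rule ext)
  then show ?thesis
    using x by simp
qed

text \<open>Twice a multiple of \<open>h\<close> is again a multiple, so by (O4)
  \<open>s + s\<close> is a supremum of elements below \<open>s\<close>.\<close>

lemma idempotent_if_rep_const:
  assumes "rep s (\<lambda>_. h)"
  shows "s \<in> idempotents S"
proof -
  note sc = rep_sup(1)[OF assms] and hc = chain_closed[OF rep_chain[OF assms]]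
  let ?u = "osum S (\<lambda>_. h)"
  have inc: "increasing S ?u"
    using hc by (intro increasing_osum)
  have sup: "is_seq_sup S s ?u"
    using assms by (simp add: rep_def)
  have uc: "?u n \<in> carrier S" for n
    by (rule increasing_closed[OF inc])
  have "is_seq_sup S (s \<boxplus> s) (\<lambda>n. ?u n \<boxplus> ?u n)"
    by (rule O4[OF inc inc sup sup])
  moreover have "?u n \<boxplus> ?u n \<sqsubseteq> s" for n
    unfolding osum_const_add[OF hc] by (rule rep_sup(2)[OF assms])
  ultimately have "s \<boxplus> s \<sqsubseteq> s"
    using sc uc is_seq_sup_iff[of "\<lambda>n. ?u n \<boxplus> ?u n" S "s \<boxplus> s"] by simp
  then have "s \<boxplus> s = s"
    using sc by (intro le_antisym) (simp_all add: le_add_right)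
  then show ?thesis
    using sc by (simp add: idempotents_def)
qed

text \<open>Infinity times \<open>h\<close>, the supremum of its multiples. On idempotents it
  inverts the meet with \<open>e\<close>, since \<open>y\<close> has the constant coefficients
  \<open>y\<close> meet \<open>e\<close>.\<close>

definition omega :: "'a \<Rightarrow> 'a" where
  "omega h = (SOME s. rep s (\<lambda>_. h))"

lemma rep_omega:
  assumes "h \<in> H"
  shows "rep (omega h) (\<lambda>_. h)"
  unfolding omega_def
  by (rule someI_ex, rule chain_has_rep) (use assms in \<open>simp add: chain_def H_iff\<close>)

lemma omega_idempotent: "h \<in> H \<Longrightarrow> omega h \<in> idempotents S"
  by (rule idempotent_if_rep_const[OF rep_omega])

lemma omega_le_iff:
  assumes "h \<in> H" "y \<in> idempotents S"
  shows "omega h \<sqsubseteq> y \<longleftrightarrow> h \<sqsubseteq> y"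
  using rep_le_iff[OF rep_omega[OF assms(1)] rep_idempotent[OF assms(2)]] assms
  by (simp add: le_meet_iff idempotents_closed H_iff)

lemma omega_mono_iff:
  assumes "h \<in> H" "k \<in> H"
  shows "omega h \<sqsubseteq> omega k \<longleftrightarrow> h \<sqsubseteq> k"
  using rep_le_iff[OF rep_omega[OF assms(1)] rep_omega[OF assms(2)]] by simp

lemma e_H [simp]: "e \<in> H"
  by (simp add: H_iff)

text \<open>All coefficients of all elements lie below \<open>e\<close>. So infinity times
  \<open>e\<close> is the top element excluded in the definition of maximal idempotents.\<close>

lemma greatest_omega_e: "greatest S (omega e) (carrier S)"
  unfolding greatest_def
proof (intro conjI ballI)
  show "omega e \<in> carrier S"
    by (rule idempotents_closed[OF omega_idempotent]) simp
  fix s assume "s \<in> carrier S"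
  then have "rep s (coeff s)"
    by (rule rep_coeff)
  then show "s \<sqsubseteq> omega e"
    using rep_le_iff[OF _ rep_omega[OF e_H]] chain_H[OF rep_chain] by (simp add: H_iff)
qed simp

section \<open>Points and the hull-kernel topology\<close>

abbreviation points where "points \<equiv> maximal_idempotents S"

text \<open>The complement of the hull of \<open>h\<close>: the points where \<open>h\<close>, seen
  as an indicator, takes the value 1.\<close>

definition basic_open :: "'a \<Rightarrow> 'a set" where
  "basic_open h = {p \<in> points. \<not> h \<sqsubseteq> p}"

lemma points_idempotent: "p \<in> points \<Longrightarrow> p \<in> idempotents S"
  by (simp add: maximal_idempotents_def)

lemma points_closed: "p \<in> points \<Longrightarrow> p \<in> carrier S"
  by (simp add: points_idempotent idempotents_closed)

lemma not_e_le_point: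
  assumes "p \<in> points"
  shows "\<not> e \<sqsubseteq> p"
proof
  assume "e \<sqsubseteq> p"
  then have "omega e \<sqsubseteq> p"
    using omega_le_iff[OF e_H points_idempotent[OF assms]] by simp
  moreover have "p \<sqsubseteq> omega e"
    using greatest_omega_e points_closed[OF assms] by (simp add: greatest_def)
  ultimately have "p = omega e"
    using points_closed[OF assms] greatest_omega_e by (intro le_antisym) (simp_all add: greatest_def)
  then show False
    using greatest_omega_e assms by (simp add: maximal_idempotents_def)
qed

text \<open>(C1), applied to the idempotents generated by \<open>h\<close> and \<open>k\<close>,
  provides enough points to recover the order of \<open>H\<close>.\<close>

lemma basic_open_subset_iff:
  assumes "h \<in> H" "k \<in> H"
  shows "basic_open h \<subseteq> basic_open k \<longleftrightarrow> h \<sqsubseteq> k"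
proof -
  have "h \<sqsubseteq> k \<longleftrightarrow> {p \<in> points. omega k \<sqsubseteq> p} \<subseteq> {p \<in> points. omega h \<sqsubseteq> p}"
    using C1 omega_idempotent assms omega_mono_iff[OF assms] unfolding condition_C1_def by blast
  also have "\<dots> \<longleftrightarrow> (\<forall>p\<in>points. k \<sqsubseteq> p \<longrightarrow> h \<sqsubseteq> p)"
    using omega_le_iff[OF assms(1)] omega_le_iff[OF assms(2)] points_idempotent by auto
  also have "\<dots> \<longleftrightarrow> basic_open h \<subseteq> basic_open k"
    unfolding basic_open_def by blast
  finally show ?thesis
    by simp
qed

text \<open>If \<open>k\<close> is not below \<open>p\<close> then \<open>k \<or> (p \<and> e)\<close> generates an idempotent strictly above \<open>p\<close>, so
  it is \<open>e\<close>, and distributivity puts \<open>h\<close> below \<open>p\<close>.\<close>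

lemma point_prime:
  assumes p: "p \<in> points" and h: "h \<in> H" and k: "k \<in> H" and le: "h \<sqinter> k \<sqsubseteq> p"
  shows "h \<sqsubseteq> p \<or> k \<sqsubseteq> p"
proof (rule disjCI)
  assume nk: "\<not> k \<sqsubseteq> p"
  note pc = points_closed[OF p] and hc = H_closed[OF h] and kc = H_closed[OF k]
  define q where "q = p \<sqinter> e"
  have qc: "q \<in> carrier S" and qp: "q \<sqsubseteq> p" and qe: "q \<sqsubseteq> e"
    using pc by (simp_all add: q_def meet_lower)
  have kq: "k \<squnion> q \<in> H"
    using k kc qc qe by (simp add: H_iff join_le_iff)
  have "p \<sqsubseteq> omega (k \<squnion> q)"
    using rep_le_iff[OF rep_idempotent[OF points_idempotent[OF p]] rep_omega[OF kq]]
      join_upper(2)[OF kc qc] by (simp add: q_def)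
  moreover have "omega (k \<squnion> q) \<noteq> p"
  proof
    assume "omega (k \<squnion> q) = p"
    then have "k \<squnion> q \<sqsubseteq> p"
      using omega_le_iff[OF kq points_idempotent[OF p]] pc by simp
    then show False
      using nk join_le_iff[OF kc qc pc] by simp
  qed
  ultimately have "greatest S (omega (k \<squnion> q)) (carrier S)"
    using p omega_idempotent[OF kq] unfolding maximal_idempotents_def by blast
  then have "e \<sqsubseteq> omega (k \<squnion> q)"
    by (simp add: greatest_def)
  moreover have "e \<sqsubseteq> omega e"
    using greatest_omega_e by (simp add: greatest_def)
  ultimately have "e \<sqsubseteq> k \<squnion> q"
    using omega_le_iff[OF e_H omega_idempotent[OF kq]] omega_mono_iff[OF e_H kq] by simp
  then have "h \<sqsubseteq> k \<squnion> q"
    using le_trans[of h e "k \<squnion> q"] h kc qc by (simp add: H_iff)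
  then have "h \<sqsubseteq> h \<sqinter> (k \<squnion> q)"
    using hc kc qc by (simp add: le_meet_iff)
  also have "h \<sqinter> (k \<squnion> q) = (h \<sqinter> k) \<squnion> (h \<sqinter> q)"
    using hc kc qc by (rule meet_join_distrib)
  finally have *: "h \<sqsubseteq> (h \<sqinter> k) \<squnion> (h \<sqinter> q)" .
  have "h \<sqinter> q \<sqsubseteq> p"
    using le_trans[OF meet_lower(2)[OF hc qc] qp] hc qc pc by simp
  then have "(h \<sqinter> k) \<squnion> (h \<sqinter> q) \<sqsubseteq> p"
    using le hc kc qc pc by (simp add: join_le_iff)
  from le_trans[OF * this] show "h \<sqsubseteq> p"
    using hc kc qc pc by simp
qed

lemma meet_H: "\<lbrakk>h \<in> H; k \<in> H\<rbrakk> \<Longrightarrow> h \<sqinter> k \<in> H"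
  using H_downward[of h "h \<sqinter> k"] by (simp add: H_closed meet_lower)

text \<open>The intersection lies in the basic set of the meet because points are prime; the
  converse inclusion is monotonicity.\<close>

lemma basic_open_meet:
  assumes "h \<in> H" "k \<in> H"
  shows "basic_open (h \<sqinter> k) = basic_open h \<inter> basic_open k"
proof -
  have "h \<sqinter> k \<sqsubseteq> p \<longleftrightarrow> h \<sqsubseteq> p \<or> k \<sqsubseteq> p" if p: "p \<in> points" for p
    using point_prime[OF p assms] points_closed[OF p] assms[THEN H_closed]
      le_trans[OF meet_lower(1)] le_trans[OF meet_lower(2)] meet_closed by metis
  then show ?thesis
    unfolding basic_open_def by auto
qed

lemma basic_open_join:
  assumes "h \<in> carrier S" "k \<in> carrier S"
  shows "basic_open (h \<squnion> k) = basic_open h \<union> basic_open k"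
  using assms points_closed by (auto simp: basic_open_def join_le_iff)

text \<open>A point lies above \<open>a\<close> exactly when it lies above all of \<open>A\<close>;
  complements turn this into a union.\<close>

lemma basic_open_lub:
  assumes "A \<subseteq> H" "is_lub S a A"
  shows "a \<in> H" "basic_open a = \<Union> (basic_open ` A)"
proof -
  have A: "A \<subseteq> carrier S"
    using assms(1) H_closed by blast
  note lub = assms(2)[unfolded is_lub_iff[OF A]]
  have "\<forall>h\<in>A. h \<sqsubseteq> e"
    using assms(1) H_iff by blast
  then show "a \<in> H"
    using lub by (simp add: H_iff)
  have "a \<sqsubseteq> p \<longleftrightarrow> (\<forall>h\<in>A. h \<sqsubseteq> p)" if p: "p \<in> points" for p
  proof
    assume ap: "a \<sqsubseteq> p"
    show "\<forall>h\<in>A. h \<sqsubseteq> p"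
    proof
      fix h assume "h \<in> A"
      then show "h \<sqsubseteq> p"
        using le_trans[of h a p] ap lub A points_closed[OF p] by blast
    qed
  qed (use lub points_closed[OF p] in blast)
  then show "basic_open a = \<Union> (basic_open ` A)"
    unfolding basic_open_def by blast
qed

text \<open>The basic sets are all the open sets, not just a base: meets give intersections, and the
  suprema provided by completeness give arbitrary unions.\<close>

definition hull_kernel :: "'a topology" where
  "hull_kernel = topology (\<lambda>U. \<exists>h\<in>H. U = basic_open h)"

lemma openin_hull_kernel: "openin hull_kernel U \<longleftrightarrow> (\<exists>h\<in>H. U = basic_open h)"
proof -
  have "istopology (\<lambda>U. \<exists>h\<in>H. U = basic_open h)"
    unfolding istopology_def
  proof (intro conjI allI impI)
    fix U V assume "\<exists>h\<in>H. U = basic_open h" "\<exists>h\<in>H. V = basic_open h"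
    then obtain h k where "h \<in> H" "k \<in> H" "U = basic_open h" "V = basic_open k"
      by blast
    then show "\<exists>h\<in>H. U \<inter> V = basic_open h"
      by (intro bexI[of _ "h \<sqinter> k"]) (simp_all add: basic_open_meet meet_H)
  next
    fix K assume K: "\<forall>U\<in>K. \<exists>h\<in>H. U = basic_open h"
    define A where "A = {h \<in> H. basic_open h \<in> K}"
    have "A \<subseteq> carrier S" and "A \<subseteq> H"
      by (auto simp: A_def H_closed)
    from \<open>A \<subseteq> carrier S\<close> have "\<exists>a. is_lub S a A"
      by (rule sup_complete[unfolded sup_complete_def, rule_format])
    then obtain a where a: "is_lub S a A"
      by (rule exE)
    have "basic_open ` A = K"
    proof (intro equalityI subsetI)
      fix U assume "U \<in> K"
      obtain h where "h \<in> H" "U = basic_open h"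
        using bspec[OF K \<open>U \<in> K\<close>] by (rule bexE) (rule that)
      then show "U \<in> basic_open ` A"
        using \<open>U \<in> K\<close> by (simp add: A_def)
    qed (auto simp: A_def)
    then show "\<exists>h\<in>H. \<Union> K = basic_open h"
      using basic_open_lub[OF \<open>A \<subseteq> H\<close> a] by (intro bexI[of _ a]) simp_all
  qed
  then show ?thesis
    by (simp add: hull_kernel_def topology_inverse')
qed

lemma basic_open_e: "basic_open e = points"
  using not_e_le_point by (auto simp: basic_open_def)

lemma topspace_hull_kernel [simp]: "topspace hull_kernel = points"
proof (rule antisym)
  show "topspace hull_kernel \<subseteq> points"
    using openin_topspace[of hull_kernel] unfolding openin_hull_kernel
    by (auto simp: basic_open_def)
  have "openin hull_kernel points"
    unfolding openin_hull_kernel using basic_open_e e_H by blast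
  then show "points \<subseteq> topspace hull_kernel"
    by (rule openin_subset)
qed

text \<open>Distinct maximal idempotents are incomparable, and idempotents compare like their meets
  with \<open>e\<close>; hence the basic set of \<open>y\<close> meet \<open>e\<close> contains
  \<open>x\<close> and misses \<open>y\<close>.\<close>

lemma t1_space_hull_kernel: "t1_space hull_kernel"
  unfolding t1_space_def topspace_hull_kernel
proof (intro ballI impI)
  fix x y assume x: "x \<in> points" and y: "y \<in> points" and "x \<noteq> y"
  note yc = points_closed[OF y]
  have yH: "y \<sqinter> e \<in> H"
    using yc by (simp add: H_iff meet_lower)
  have "\<not> y \<sqsubseteq> x"
    using x y \<open>x \<noteq> y\<close> unfolding maximal_idempotents_def by blast
  moreover have "y \<sqsubseteq> x" if "y \<sqinter> e \<sqsubseteq> x"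
    using that rep_le_iff[OF rep_idempotent rep_idempotent, OF points_idempotent[OF y]
        points_idempotent[OF x]] points_closed[OF x] yc
    by (simp add: le_meet_iff meet_lower)
  ultimately have "x \<in> basic_open (y \<sqinter> e)" "y \<notin> basic_open (y \<sqinter> e)"
    using x yc by (auto simp: basic_open_def meet_lower)
  then show "\<exists>U. openin hull_kernel U \<and> x \<in> U \<and> y \<notin> U"
    using yH openin_hull_kernel by blast
qed

section \<open>The function attached to an element\<close>

text \<open>The layers decrease, so the qualifying indices form an initial segment and the supremum
  of \<open>i + 1\<close> is their number; over no index it is 0.\<close>

definition level :: "'a \<Rightarrow> 'a \<Rightarrow> enat" where
  "level s = (\<lambda>p\<in>points. SUP i\<in>{i. p \<in> basic_open (coeff s i)}. enat (Suc i))"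

lemma coeff_H: "s \<in> carrier S \<Longrightarrow> coeff s i \<in> H"
  by (rule chain_H[OF rep_chain[OF rep_coeff]])

lemma Suc_le_level_iff:
  assumes "s \<in> carrier S" "p \<in> points"
  shows "enat (Suc i) \<le> level s p \<longleftrightarrow> p \<in> basic_open (coeff s i)"
proof -
  have "p \<in> basic_open (coeff s i)" if "p \<in> basic_open (coeff s j)" "i \<le> j" for j
    using that basic_open_subset_iff[OF coeff_H coeff_H, OF assms(1,1)]
      chain_mono[OF rep_chain[OF rep_coeff[OF assms(1)]] that(2)] by blast
  then show ?thesis
    using assms(2) by (auto simp: level_def enat_Suc_le_SUP_iff)
qed

lemma level_set:
  assumes "s \<in> carrier S"
  shows "{p \<in> points. enat (Suc i) \<le> level s p} = basic_open (coeff s i)"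
  using Suc_le_level_iff[OF assms] by (auto simp: basic_open_def)

lemma level_closed:
  assumes "s \<in> carrier S"
  shows "level s \<in> carrier (Lsc hull_kernel)"
  using coeff_H[OF assms]
  by (auto simp: Lsc_carrier_iff level_set[OF assms] openin_hull_kernel) (simp add: level_def)

lemma level_le_iff:
  assumes "s \<in> carrier S" "t \<in> carrier S"
  shows "level s \<sqsubseteq>\<^bsub>Lsc hull_kernel\<^esub> level t \<longleftrightarrow> s \<sqsubseteq> t"
proof -
  have "level s \<sqsubseteq>\<^bsub>Lsc hull_kernel\<^esub> level t \<longleftrightarrow>
      (\<forall>i. \<forall>p\<in>points. enat (Suc i) \<le> level s p \<longrightarrow> enat (Suc i) \<le> level t p)"
    by (auto simp: Lsc_simps intro: enat_le_cases order_trans)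
  also have "\<dots> \<longleftrightarrow> (\<forall>i. basic_open (coeff s i) \<subseteq> basic_open (coeff t i))"
    unfolding level_set[OF assms(1), symmetric] level_set[OF assms(2), symmetric] by blast
  also have "\<dots> \<longleftrightarrow> s \<sqsubseteq> t"
    using assms by (simp add: basic_open_subset_iff coeff_H le_iff_coeff_le)
  finally show ?thesis .
qed

text \<open>The superlevel sets of \<open>f\<close> are open, hence basic. Their labels decrease
  because inclusion of basic sets reflects the order, so they are the coefficients of some
  \<open>s\<close>.\<close>

lemma level_surj:
  assumes f: "f \<in> carrier (Lsc hull_kernel)"
  shows "\<exists>s\<in>carrier S. level s = f"
proof -
  have "\<forall>i. \<exists>h\<in>H. {p \<in> points. enat (Suc i) \<le> f p} = basic_open h"
    using Lsc_openin[OF f] unfolding openin_hull_kernel topspace_hull_kernel by blast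
  then obtain x where x: "\<And>i. x i \<in> H"
      "\<And>i. {p \<in> points. enat (Suc i) \<le> f p} = basic_open (x i)"
    by metis
  have "basic_open (x (Suc i)) \<subseteq> basic_open (x i)" for i
    unfolding x(2)[symmetric] by (auto intro: order_trans[rotated])
  then have "chain x"
    using x(1) by (simp add: chain_def basic_open_subset_iff)
  then obtain s where s: "rep s x"
    using chain_has_rep by blast
  note sc = rep_sup(1)[OF s]
  have "level s = f"
  proof (rule Lsc_eqI[OF level_closed[OF sc] f])
    fix p assume "p \<in> topspace hull_kernel"
    then have p: "p \<in> points"
      by simp
    show "level s p = f p"
      by (rule enat_eqI) (use Suc_le_level_iff[OF sc p] coeff_eqI[OF s] x(2) p in auto)
  qed
  then show ?thesis
    using sc by blast
qed

lemma level_zero: "p \<in> points \<Longrightarrow> level (ozero S) p = 0"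
proof -
  assume p: "p \<in> points"
  have "rep (osum S (\<lambda>_. ozero S) 0) (\<lambda>_. ozero S)"
    by (rule rep_finite) (simp_all add: chain_def)
  then have "coeff (ozero S) = (\<lambda>_. ozero S)"
    by (intro coeff_eqI) simp
  moreover have "basic_open (ozero S) = {}"
    using zero_le points_closed by (auto simp: basic_open_def)
  ultimately show ?thesis
    using p by (simp add: level_def bot_enat_def)
qed

lemma finite_sums_add_H: "\<lbrakk>h \<in> H; s \<in> finite_sums S H\<rbrakk> \<Longrightarrow> h \<boxplus> s \<in> finite_sums S H"
proof -
  assume h: "h \<in> H" and s: "s \<in> finite_sums S H"
  obtain x m where x: "chain x" "\<And>i. m \<le> i \<Longrightarrow> x i = ozero S" "s = osum S x m"
    using s by (rule finite_sums_chain) (rule that)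
  have "h \<boxplus> s = osum S (insert_chain h x) (Suc m)"
    unfolding x(3) by (rule add_finite_chain(1)[OF h x(1,2)])
  then show ?thesis
    unfolding finite_sums_def using chain_H[OF chain_insert[OF h x(1)]] by blast
qed

text \<open>The \<open>i\<close>-th term after insertion is \<open>x i\<close> joined with the meet
  of \<open>h\<close> and \<open>x (i - 1)\<close> (just \<open>h\<close> for \<open>i = 0\<close>).
  At \<open>p\<close> this says that height \<open>i + 1\<close> was reached before, or that
  \<open>p\<close> lies in \<open>basic_open h\<close> and height \<open>i\<close> was reached: the
  indicator of \<open>h\<close> is added.\<close>

lemma level_add_H:
  assumes h: "h \<in> H" and s: "s \<in> finite_sums S H" and p: "p \<in> points"
  shows "level (h \<boxplus> s) p = (if p \<in> basic_open h then 1 else 0) + level s p"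
proof -
  obtain x m where x: "chain x" "\<And>i. m \<le> i \<Longrightarrow> x i = ozero S" "s = osum S x m"
    using s by (rule finite_sums_chain) (rule that)
  note y = chain_insert[OF h x(1)]
  note xc = chain_closed[OF x(1)] and xH = chain_H[OF x(1)] and hc = H_closed[OF h]
  have s_coeff: "coeff s = x"
    unfolding x(3) by (rule coeff_eqI[OF rep_finite[OF x(1,2)]])
  have "h \<boxplus> s = osum S (insert_chain h x) (Suc m)"
    unfolding x(3) by (rule add_finite_chain(1)[OF h x(1,2)])
  moreover have "rep (osum S (insert_chain h x) (Suc m)) (insert_chain h x)"
    using add_finite_chain(2)[OF h x(1,2)] by (intro rep_finite[OF y])
  ultimately have hs_coeff: "coeff (h \<boxplus> s) = insert_chain h x"
    by (intro coeff_eqI) simp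
  have sc: "s \<in> carrier S" and hsc: "h \<boxplus> s \<in> carrier S"
    using finite_sums_closed[OF s] hc by simp_all
  show ?thesis
  proof (rule enat_eqI)
    fix i
    have "enat (Suc i) \<le> level (h \<boxplus> s) p \<longleftrightarrow>
        p \<in> basic_open (insert_rest h x i) \<or> p \<in> basic_open (x i)"
      using insert_rest_closed[OF h x(1)] xc
      by (simp add: Suc_le_level_iff[OF hsc p] hs_coeff insert_chain_def basic_open_join)
    also have "\<dots> \<longleftrightarrow> enat (Suc i) \<le> (if p \<in> basic_open h then 1 else 0) + level s p"
    proof (cases i)
      case 0
      then show ?thesis
        using Suc_le_level_iff[OF sc p, of 0]
        by (simp add: s_coeff insert_rest_def enat_Suc_le_one_add zero_enat_def[symmetric])
    next
      case (Suc j)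
      \<comment> \<open>When \<open>p\<close> lies in \<open>basic_open h\<close>, the layer
        \<open>x (Suc j)\<close> is absorbed by \<open>x j\<close>.\<close>
      have "basic_open (x (Suc j)) \<subseteq> basic_open (x j)"
        using x(1) xH by (simp add: basic_open_subset_iff chain_def)
      then show ?thesis
        using Suc_le_level_iff[OF sc p]
        by (auto simp: Suc s_coeff insert_rest_def enat_Suc_le_one_add basic_open_meet h xH)
    qed
    finally show "enat (Suc i) \<le> level (h \<boxplus> s) p \<longleftrightarrow>
        enat (Suc i) \<le> (if p \<in> basic_open h then 1 else 0) + level s p" .
  qed
qed

text \<open>Closure under sums is carried along because the induction step applies
  \<open>level_add_H\<close> to \<open>h\<close> and the finite sum \<open>s + t\<close>.\<close>

lemma level_add_finite_sums:
  assumes "s \<in> finite_sums S H" and t: "t \<in> finite_sums S H" and p: "p \<in> points"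
  shows "s \<boxplus> t \<in> finite_sums S H \<and> level (s \<boxplus> t) p = level s p + level t p"
  using assms(1)
proof (induction rule: finite_sums_induct)
  case zero
  then show ?case
    using t finite_sums_closed[OF t] by (simp add: level_zero[OF p])
next
  case (add h s)
  have eq: "h \<boxplus> s \<boxplus> t = h \<boxplus> (s \<boxplus> t)"
    using add(1,2) t by (intro oplus_assoc) (simp_all add: H_closed finite_sums_closed)
  show ?case
    unfolding eq using add by (simp add: finite_sums_add_H level_add_H p add.assoc)
qed

text \<open>No coefficients are computed: \<open>level\<close> preserves and reflects the order and
  is surjective, so it preserves suprema, and those of functions are pointwise.\<close>

lemma level_sup:
  assumes z: "increasing S z" and s: "is_seq_sup S s z" and p: "p \<in> points"
  shows "level s p = (SUP n. level (z n) p)"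
proof -
  note zc = increasing_closed[OF z]
  note s' = s[unfolded is_seq_sup_iff[of z, OF zc]]
  interpret L: partial_order "Lsc hull_kernel"
    by (rule partial_order_Lsc)
  have r: "range (\<lambda>n. level (z n)) \<subseteq> carrier (Lsc hull_kernel)"
    using level_closed[OF zc] by blast
  have "is_seq_sup (Lsc hull_kernel) (level s) (\<lambda>n. level (z n))"
    unfolding is_seq_sup_iff[of "\<lambda>n. level (z n)", OF level_closed[OF zc]]
  proof (intro conjI ballI allI impI)
    show "level s \<in> carrier (Lsc hull_kernel)"
      using s' by (simp add: level_closed)
    show "level (z n) \<sqsubseteq>\<^bsub>Lsc hull_kernel\<^esub> level s" for n
      using s' zc by (simp add: level_le_iff)
    fix t assume t: "t \<in> carrier (Lsc hull_kernel)"
      "\<forall>n. level (z n) \<sqsubseteq>\<^bsub>Lsc hull_kernel\<^esub> t"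
    obtain t' where t': "t' \<in> carrier S" "level t' = t"
      using level_surj[OF t(1)] by (rule bexE) (rule that)
    have "z n \<sqsubseteq> t'" for n
      using t(2) zc t' level_le_iff[of "z n" t'] by simp
    then show "level s \<sqsubseteq>\<^bsub>Lsc hull_kernel\<^esub> t"
      using s' t' level_le_iff[of s t'] by simp
  qed
  from L.least_unique[OF this Lsc_lub_SUP[OF r]] show ?thesis
    using p by (simp add: image_image)
qed

text \<open>Both summands are approximated by finite sums; (O4) in \<open>S\<close> and its
  counterpart for extended naturals let additivity pass to suprema.\<close>

lemma level_add:
  assumes "s \<in> carrier S" "t \<in> carrier S" and p: "p \<in> points"
  shows "level (s \<boxplus> t) p = level s p + level t p"
proof -
  obtain u where u: "increasing S u" "\<And>n. u n \<in> finite_sums S H" "is_seq_sup S s u"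
    by (rule finite_sums_sup[OF assms(1)]) (rule that)
  obtain v where v: "increasing S v" "\<And>n. v n \<in> finite_sums S H" "is_seq_sup S t v"
    by (rule finite_sums_sup[OF assms(2)]) (rule that)
  note uc = increasing_closed[OF u(1)] and vc = increasing_closed[OF v(1)]
  have mono: "mono (\<lambda>n. level (z n) p)" if z: "increasing S z" for z
  proof (rule monoI)
    fix m n :: nat assume "m \<le> n"
    then have "level (z m) \<sqsubseteq>\<^bsub>Lsc hull_kernel\<^esub> level (z n)"
      using increasing_mono[OF z] increasing_closed[OF z] by (simp add: level_le_iff)
    then show "level (z m) p \<le> level (z n) p"
      using p by (simp add: Lsc_simps)
  qed
  have "u n \<boxplus> v n \<sqsubseteq> u (Suc n) \<boxplus> v (Suc n)" for n
    using u(1) v(1) by (intro add_mono) (simp_all add: increasing_def)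
  then have "increasing S (\<lambda>n. u n \<boxplus> v n)"
    using uc vc by (intro increasingI) simp_all
  then have "level (s \<boxplus> t) p = (SUP n. level (u n \<boxplus> v n) p)"
    using O4[OF u(1) v(1) u(3) v(3)] p by (rule level_sup)
  also have "\<dots> = (SUP n. level (u n) p + level (v n) p)"
    using level_add_finite_sums[OF u(2) v(2) p] by simp
  also have "\<dots> = level s p + level t p"
    using level_sup[OF u(1,3) p] level_sup[OF v(1,3) p]
      enat_SUP_add[OF mono[OF u(1)] mono[OF v(1)]] by simp
  finally show ?thesis .
qed

lemma ordered_monoid_iso_level:
  "ordered_monoid_iso S (Lsc hull_kernel) level (inv_into (carrier S) level)"
proof (rule ordered_monoid_iso.intro)
  have inj: "inj_on level (carrier S)"
  proof (rule inj_onI)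
    fix s t assume st: "s \<in> carrier S" "t \<in> carrier S" "level s = level t"
    then show "s = t"
      using level_le_iff[of s t] level_le_iff[of t s]
      by (intro le_antisym) (simp_all add: Lsc_simps)
  qed
  have im: "level ` carrier S = carrier (Lsc hull_kernel)"
  proof (intro equalityI subsetI)
    fix f assume "f \<in> carrier (Lsc hull_kernel)"
    from level_surj[OF this] show "f \<in> level ` carrier S"
      by auto
  qed (auto simp: level_closed)
  show "partial_order S"
    by (rule partial_order_axioms)
  show "partial_order (Lsc hull_kernel)"
    by (rule partial_order_Lsc)
  show "inv_into (carrier S) level t \<in> carrier S" "level (inv_into (carrier S) level t) = t"
    if "t \<in> carrier (Lsc hull_kernel)" for t
    using that unfolding im[symmetric] by (rule inv_into_into, rule f_inv_into_f)
  show "inv_into (carrier S) level (level x) = x" if "x \<in> carrier S" for x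
    by (rule inv_into_f_f[OF inj that])
  show "level (ozero S) = ozero (Lsc hull_kernel)"
    by (rule ext) (use level_zero in \<open>auto simp: Lsc_simps level_def restrict_def\<close>)
  show "level (x \<boxplus> y) = level x \<boxplus>\<^bsub>Lsc hull_kernel\<^esub> level y"
    if "x \<in> carrier S" "y \<in> carrier S" for x y
  proof
    fix p
    show "level (x \<boxplus> y) p = (level x \<boxplus>\<^bsub>Lsc hull_kernel\<^esub> level y) p"
      using level_add[OF that, of p] by (cases "p \<in> points") (simp_all add: Lsc_simps level_def)
  qed
qed (simp_all add: level_closed level_le_iff)

end

lemma Lsc_like_imp_cu_isomorphic:
  fixes S :: "'a ordered_monoid"
  assumes "Lsc_like S"
  shows "\<exists>X :: 'a topology. t1_space X \<and> cu_isomorphic S (Lsc X)"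
proof -
  have S: "cu_semigroup S" "sup_complete S" "distributively_lattice_ordered S" "condition_C1 S"
    using assms by (simp_all add: Lsc_like_def)
  obtain e where e: "e \<in> carrier S" "topological_subset S (down_set S e)"
      "sup_dense S (finite_sums S (down_set S e))"
    using assms unfolding Lsc_like_def condition_C2_def by blast
  interpret lsc_like S e
    by (intro lsc_like.intro lsc_like_axioms.intro S e)
  interpret iso: ordered_monoid_iso S "Lsc hull_kernel" level "inv_into (carrier S) level"
    by (rule ordered_monoid_iso_level)
  show ?thesis
    using t1_space_hull_kernel iso.cu_isomorphic_iso[OF S(1)] by blast
qed

text \<open>Types cannot be quantified inside a formula. The constructed space has elements of
  \<open>S\<close> as points, hence the type \<open>'a topology\<close>; the second conjunct frees
  the converse direction from this type.\<close>

theorem theorem6p5: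
  fixes S :: "'a ordered_monoid"
  assumes "cu_semigroup S"
  shows "(Lsc_like S \<longleftrightarrow> (\<exists>X :: 'a topology. t1_space X \<and> cu_isomorphic S (Lsc X))) \<and>
         (\<forall>X :: 'b topology. t1_space X \<and> cu_isomorphic S (Lsc X) \<longrightarrow> Lsc_like S)"
  using Lsc_like_imp_cu_isomorphic[of S] Lsc_like_if_cu_isomorphic[of _ S]
    Lsc_like_if_cu_isomorphic[of _ S] by blast

end
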